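(* Let $n\ge 1$ and let $\Gamma$ be a graph with $n$ loops and $2n+2$ edges $e_1,\dots,e_{2n+2}$. Fix masses $m_i>0$ ($1\le i\le 2n+2$) and external momenta $q$, and consider the amplitude $$\mathcal{A}(\Gamma,q,m)=\int_{\mathbb{R}^{4n}}\frac{d^{4n}x}{\prod_{i=1}^{2n+2}P_i(x,q,m_i)},$$ where the $P_i$ are the euclidean propagators attached to the edges $e_i$ (as described in the context). Then there exist alternating bilinear forms $Q_i$ on $\mathbb{R}^{2n+2}$, $1\le i\le 2n+2$, where $Q_i$ depends on $P_i$, and a universal constant $C(n)$ depending only on $n$, such that $$\mathcal{A}(\Gamma,q,m)=C(n)\int_\delta\frac{\Omega_{2n+1}}{\mathrm{Pfaffian}\big(\sum_{i=1}^{2n+2}a_iQ_i\big)^2}.$$ Here $\Omega_{2n+1}=\sum_i \pm\, a_i\, da_1\wedge\cdots\wedge\widehat{da_i}\wedge\cdots\wedge da_{2n+2}$ (with alternating signs), and $\delta$ is the locus on $\mathbb{P}^{2n+1}$, with homogeneous coordinates $a_1,\dots,a_{2n+2}$, where all the $a_i\ge 0$.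
   Context: The graph $\Gamma$ is finite, with no self-loops and no multiple edges; its number of loops is $n=\dim H_1(\Gamma,\mathbb{R})$. Orient the edges. For an edge $e$, let $e^\vee:H_1(\Gamma,\mathbb{R})\to\mathbb{R}$ be the functional sending a loop (a $1$-cycle) to the coefficient of $e$ in it. Choosing a basis of $H_1(\Gamma,\mathbb{R})$ (taken integral, i.e. a $\mathbb{Z}$-basis of $H_1(\Gamma,\mathbb{Z})$, to normalize the measure), identify $\mathbb{R}^{4n}=H_1(\Gamma,\mathbb{R})\otimes_{\mathbb{R}}\mathbb{R}^4$, with points $x=(x_1,\dots,x_n)$, $x_k\in\mathbb{R}^4$, and write $e_i^\vee=(\alpha_1(e_i),\dots,\alpha_n(e_i))$ in the dual coordinates. Let $|\cdot|$ be the standard euclidean norm on $\mathbb{R}^4$. External momenta $q$ assign to each vertex a vector in $\mathbb{R}^4$, with total sum zero on each connected component. Choose a $1$-chain $s=\sum_i s_i e_i$ with $s_i\in\mathbb{R}^4$ whose boundary is $q$ (the amplitude does not depend on this choice). The euclidean propagator of $e_i$ is $$P_i(x,q,m_i)=\Big|\sum_{k=1}^n\alpha_k(e_i)x_k+s_i\Big|^2+m_i^2 .$$ The Pfaffian of an alternating form on $\mathbb{R}^{2n+2}$ is that of its matrix in the standard basis. The Pfaffian in the denominator can vanish where some of the $a_i=0$; the resulting questions of divergence are not addressed.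
   Formalization: The forms Q_i determined by P_i alone take complex values, since for n=1 real forms depending only on P_i cannot exist (signature (1,5) versus (3,3)); real alternating forms Q_i are also shown to exist, but they may depend on all the data at once. *)

theory Defs
  imports
    "HOL-Analysis.Analysis"
    "HOL-Combinatorics.Permutations"
    "HOL-Library.Function_Algebras"
    "Graph_Theory.Digraph_Component"
begin

section \<open>Graphs and their first homology\<close>

text \<open>
  An oriented finite graph without self-loops and multiple edges. The predicate \<^const>\<open>digraph\<close>
  only excludes parallel arcs with the same direction; an antiparallel pair is a double edge
  of the underlying unoriented graph and is excluded as well.
\<close>

definition oriented_simple_graph :: "('v, 'e) pre_digraph \<Rightarrow> bool" where
  "oriented_simple_graph G \<longleftrightarrow> digraph G \<and>
     (\<forall>e\<in>arcs G. \<forall>e'\<in>arcs G. \<not> (tail G e = head G e' \<and> head G e = tail G e'))"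

text \<open>A 1-chain with coefficients in an abelian group is a function on the arcs.\<close>

definition boundary :: "('v, 'e) pre_digraph \<Rightarrow> ('e \<Rightarrow> 'm::ab_group_add) \<Rightarrow> 'v \<Rightarrow> 'm" where
  "boundary G z v = (\<Sum>e\<in>in_arcs G v. z e) - (\<Sum>e\<in>out_arcs G v. z e)"

text \<open>
  A graph has no 2-cells, so its first homology is its group of 1-cycles. Chains are set to zero
  off the arcs to make them unique as functions.
\<close>

definition H1 :: "('v, 'e) pre_digraph \<Rightarrow> ('e \<Rightarrow> 'm::ab_group_add) set" where
  "H1 G = {z. (\<forall>e. e \<notin> arcs G \<longrightarrow> z e = 0) \<and> (\<forall>v\<in>verts G. boundary G z v = 0)}"

abbreviation scale_fun :: "real \<Rightarrow> ('e \<Rightarrow> real) \<Rightarrow> 'e \<Rightarrow> real" where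
  "scale_fun c z \<equiv> (\<lambda>e. c * z e)"

lemma vector_space_scale_fun: "vector_space scale_fun"
  by unfold_locales (auto simp: fun_eq_iff algebra_simps)

definition loop_number :: "('v, 'e) pre_digraph \<Rightarrow> nat" where
  "loop_number G = vector_space.dim scale_fun (H1 G :: ('e \<Rightarrow> real) set)"

definition integral_H1_basis ::
    "('v, 'e) pre_digraph \<Rightarrow> nat \<Rightarrow> (nat \<Rightarrow> 'e \<Rightarrow> int) \<Rightarrow> bool" where
  "integral_H1_basis G n b \<longleftrightarrow>
     bij_betw (\<lambda>c e. \<Sum>k<n. c k * b k e) ({..<n} \<rightarrow>\<^sub>E UNIV) (H1 G)"

section \<open>Feynman amplitudes\<close>

definition external_momenta :: "('v, 'e) pre_digraph \<Rightarrow> ('v \<Rightarrow> real^4) \<Rightarrow> bool" where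
  "external_momenta G q \<longleftrightarrow>
     (\<forall>u\<in>verts G. (\<Sum>v | reachable (with_proj (mk_symmetric G)) u v. q v) = 0)"

text \<open>
  With respect to a basis \<open>b\<close> of the integral homology, the \<open>k\<close>-th dual coordinate of the
  functional attached to the edge \<open>e\<close> is its value on \<open>b k\<close>, that is, the coefficient \<open>b k e\<close>.
\<close>

definition propagator ::
    "nat \<Rightarrow> (nat \<Rightarrow> 'e \<Rightarrow> int) \<Rightarrow> ('e \<Rightarrow> real^4) \<Rightarrow> ('e \<Rightarrow> real) \<Rightarrow> 'e \<Rightarrow> (nat \<Rightarrow> real^4) \<Rightarrow> real" where
  "propagator n b s m e x = (norm ((\<Sum>k<n. of_int (b k e) *\<^sub>R x k) + s e))\<^sup>2 + (m e)\<^sup>2"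

text \<open>
  Lebesgue measure on \<open>(\<real>\<^sup>4)\<^sup>n\<close>, with points \<open>x = (x 0, \<dots>, x (n - 1))\<close>.
\<close>

definition loop_momenta :: "nat \<Rightarrow> (nat \<Rightarrow> real^4) measure" where
  "loop_momenta n = (\<Pi>\<^sub>M k\<in>{..<n}. lborel)"

definition amplitude_integrand ::
    "nat \<Rightarrow> (nat \<Rightarrow> (nat \<Rightarrow> real^4) \<Rightarrow> real) \<Rightarrow> (nat \<Rightarrow> real^4) \<Rightarrow> real" where
  "amplitude_integrand n P x = 1 / (\<Prod>i<2*n+2. P i x)"

definition amplitude :: "nat \<Rightarrow> (nat \<Rightarrow> (nat \<Rightarrow> real^4) \<Rightarrow> real) \<Rightarrow> real" where
  "amplitude n P = (\<integral>x. amplitude_integrand n P x \<partial>loop_momenta n)"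

text \<open>
  A graph with \<open>n\<close> loops and edges \<open>0, \<dots>, 2n+1\<close>, a basis \<open>b\<close> of its integral homology,
  external momenta \<open>q\<close>, a chain \<open>s\<close> with boundary \<open>q\<close>, and masses \<open>m\<close>.
\<close>

definition feynman_data ::
    "nat \<Rightarrow> ('v, nat) pre_digraph \<Rightarrow> (nat \<Rightarrow> nat \<Rightarrow> int) \<Rightarrow> ('v \<Rightarrow> real^4) \<Rightarrow>
     (nat \<Rightarrow> real^4) \<Rightarrow> (nat \<Rightarrow> real) \<Rightarrow> bool" where
  "feynman_data n G b q s m \<longleftrightarrow>
     oriented_simple_graph G \<and>
     arcs G = {..<2*n+2} \<and>
     loop_number G = n \<and>
     integral_H1_basis G n b \<and>
     external_momenta G q \<and>
     (\<forall>v\<in>verts G. boundary G s v = q v) \<and>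
     (\<forall>i<2*n+2. m i > 0)"

section \<open>Alternating forms and Pfaffians\<close>

text \<open>
  Forms on \<open>\<real>\<^sup>d\<close>, realised as \<^term>\<open>topspace (Euclidean_space d)\<close>; the values may lie in \<open>\<real>\<close> or
  in \<open>\<complex>\<close> (linearity is over \<open>\<real>\<close> in both cases).
\<close>

definition alternating_form ::
    "nat \<Rightarrow> ((nat \<Rightarrow> real) \<Rightarrow> (nat \<Rightarrow> real) \<Rightarrow> 'a::real_vector) \<Rightarrow> bool" where
  "alternating_form d B \<longleftrightarrow>
     (\<forall>x\<in>topspace (Euclidean_space d). \<forall>y\<in>topspace (Euclidean_space d).
      \<forall>z\<in>topspace (Euclidean_space d). \<forall>c.
        B (\<lambda>j. c * x j + y j) z = c *\<^sub>R B x z + B y z \<and>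
        B z (\<lambda>j. c * x j + y j) = c *\<^sub>R B z x + B z y) \<and>
     (\<forall>x\<in>topspace (Euclidean_space d). B x x = 0)"

definition std_basis :: "nat \<Rightarrow> nat \<Rightarrow> real" where
  "std_basis i = (\<lambda>j. if j = i then 1 else 0)"

definition pfaffian_matrix :: "nat \<Rightarrow> (nat \<Rightarrow> nat \<Rightarrow> 'a::field) \<Rightarrow> 'a" where
  "pfaffian_matrix r A =
     (\<Sum>p | p permutes {..<2*r}. of_int (sign p) * (\<Prod>i<r. A (p (2*i)) (p (2*i+1))))
       / of_nat (2^r * fact r)"

text \<open>The Pfaffian of an alternating form on \<open>\<real>\<^sup>2\<^sup>r\<close>.\<close>

definition pfaffian :: "nat \<Rightarrow> ((nat \<Rightarrow> real) \<Rightarrow> (nat \<Rightarrow> real) \<Rightarrow> 'a::field) \<Rightarrow> 'a" where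
  "pfaffian r B = pfaffian_matrix r (\<lambda>i j. B (std_basis i) (std_basis j))"

section \<open>Integration over the simplex in projective space\<close>

text \<open>
  Let \<open>f\<close> be homogeneous of degree \<open>-(d+1)\<close> in \<open>a 0, \<dots>, a d\<close>, so that \<open>f \<Omega>\<close> is a differential
  form on \<open>\<P>\<^sup>d\<close>. On the affine chart \<open>a d = 1\<close>, whose complement in \<open>\<delta>\<close> is a null set, all terms
  of \<open>\<Omega>\<close> but the one omitting \<open>da d\<close> vanish, and \<open>\<Omega>\<close> becomes
  \<open>\<plusminus> da 0 \<and> \<dots> \<and> da (d - 1)\<close>. We orient \<open>\<delta>\<close> so that this is Lebesgue measure.
\<close>

definition affine_delta :: "nat \<Rightarrow> (nat \<Rightarrow> real) set" where
  "affine_delta d = {a. \<forall>i<d. a i \<ge> 0}"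

definition delta_integrable ::
    "nat \<Rightarrow> ((nat \<Rightarrow> real) \<Rightarrow> 'a::{banach, second_countable_topology}) \<Rightarrow> bool" where
  "delta_integrable d f \<longleftrightarrow>
     set_integrable (\<Pi>\<^sub>M i\<in>{..<d}. lborel) (affine_delta d) (\<lambda>a. f (a(d := 1)))"

definition delta_integral ::
    "nat \<Rightarrow> ((nat \<Rightarrow> real) \<Rightarrow> 'a::{banach, second_countable_topology}) \<Rightarrow> 'a" where
  "delta_integral d f = (LINT a:affine_delta d|(\<Pi>\<^sub>M i\<in>{..<d}. lborel). f (a(d := 1)))"

section \<open>The Pfaffian formula\<close>

definition pfaffian_integrand ::
    "nat \<Rightarrow> (nat \<Rightarrow> (nat \<Rightarrow> real) \<Rightarrow> (nat \<Rightarrow> real) \<Rightarrow> 'a::real_normed_field) \<Rightarrow> (nat \<Rightarrow> real) \<Rightarrow> 'a" where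
  "pfaffian_integrand n Q a =
     1 / (pfaffian (n+1) (\<lambda>x y. \<Sum>i<2*n+2. a i *\<^sub>R Q i x y))\<^sup>2"

text \<open>
  Both sides are Bochner integrals, which are \<open>0\<close> if divergent; the formula
  therefore also asserts that the two sides converge or diverge together.
\<close>

definition pfaffian_formula ::
    "nat \<Rightarrow> real \<Rightarrow> (nat \<Rightarrow> (nat \<Rightarrow> real^4) \<Rightarrow> real) \<Rightarrow>
     (nat \<Rightarrow> (nat \<Rightarrow> real) \<Rightarrow> (nat \<Rightarrow> real) \<Rightarrow> 'a::{real_normed_field, banach, second_countable_topology}) \<Rightarrow>
     bool" where
  "pfaffian_formula n C P Q \<longleftrightarrow>
     (integrable (loop_momenta n) (amplitude_integrand n P) \<longleftrightarrow>
        delta_integrable (2*n+1) (pfaffian_integrand n Q)) \<and>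
     of_real (amplitude n P) = of_real C * delta_integral (2*n+1) (pfaffian_integrand n Q)"

end

theory Submission
  imports
    Defs
    "HOL-Analysis.Kronecker_Approximation_Theorem"
    "Jordan_Normal_Form.Determinant"
begin

text \<open>
  Put \<open>d = 2 n + 1\<close>. Feynman's identity
  \<open>1 / (P\<^sub>0 \<cdots> P\<^sub>d) = d! \<integral>\<^sub>\<delta> \<Omega> / (\<Sum>\<^sub>i a\<^sub>i P\<^sub>i)\<^bsup>d+1\<^esup>\<close> (theorem \<open>feynman_parametrization\<close>) turns
  the amplitude into an integral over \<open>\<delta>\<close> whose inner integrand, for fixed \<open>a\<close>, is a power of one
  quadratic polynomial \<open>\<Sum> M\<^sub>k\<^sub>l \<langle>x\<^sub>k, x\<^sub>l\<rangle> + 2 \<Sum> \<langle>B\<^sub>k, x\<^sub>k\<rangle> + c\<close> on \<open>(\<real>\<^sup>4)\<^sup>n\<close>. The loop momenta are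
  integrated out one after the other. Completing the square in \<open>x\<^sub>k\<close> with pivot \<open>\<mu> = M\<^sub>k\<^sub>k\<close>, the integral
  over \<open>\<real>\<^sup>4\<close> produces a numerical constant and \<open>\<mu>\<^bsup>-2\<^esup>\<close>, lowers the exponent by 2, and replaces
  \<open>(M, B, c)\<close> by its Schur complement. The exponent is \<open>2 n + 2\<close> at the start, hence 2 after \<open>n\<close> steps,
  so the pivots and the last constant end up with the same exponent: the result is a constant times
  \<open>\<Psi>\<^bsup>-2\<^esup>\<close>, where \<open>\<Psi>\<close> (called \<open>symanzik\<close> below) is the product of the pivots and the last constant.
  This balance is what singles out graphs with \<open>2 n + 2\<close> edges in dimension 4
  (theorem \<open>nn_integral_quadratic\<close>).
  
  It remains to see \<open>\<Psi>\<close> as a Pfaffian that is linear in \<open>(M, B, c)\<close>. Reading \<open>\<real>\<^sup>4\<close> as the quaternions,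
  \<open>\<Psi>\<close> is the determinant of the Hermitian quaternionic matrix with blocks \<open>c\<close>, \<open>B\<close>, \<open>M\<close>. Writing a
  quaternion as a complex \<open>2 \<times> 2\<close> matrix and multiplying by the standard symplectic matrix makes
  this an alternating complex matrix of size \<open>2 n + 2\<close>. A Pfaffian can be computed by eliminating
  \<open>2 \<times> 2\<close> pivot blocks (theorem \<open>pfaffian_matrix_pivot\<close>), and because the determinant of the block of a
  quaternion is the square of its norm, this elimination is the very recursion that defines \<open>\<Psi>\<close>
  (theorem \<open>pfaffian_momentum_matrix\<close>). The coefficients of \<open>\<Sum> a\<^sub>i P\<^sub>i\<close> are linear in \<open>a\<close>, and those of
  \<open>P\<^sub>i\<close> are recovered from the function \<open>P\<^sub>i\<close> by polarization, so the forms depend on \<open>P\<^sub>i\<close> alone.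
  
  The elimination needs \<open>M\<close> to be positive definite. This holds where all \<open>a\<^sub>i\<close> are positive, which is
  almost everywhere on \<open>\<delta>\<close>, because a basis of the integral homology is linearly independent over the
  reals (lemma \<open>integral_H1_basis_real_independent\<close>). All integrands are nonnegative, so Tonelli's
  theorem gives an equality in \<open>[0, \<infinity>]\<close>, and convergence on one side is convergence on the other.
  
  The quaternionic construction is complex. For real forms that may depend on all the data at once
  only the value of the integral has to be matched, and multiples of a single form suffice
  (lemma \<open>real_pfaffian_formula_exists\<close>).
\<close>

no_notation scalar_prod (infix "\<bullet>" 70)

section \<open>Pfaffians under congruence and elimination\<close>

lemma prod_pairs: "(\<Prod>j<2*r. h j) = (\<Prod>i<r. h (2*i) * h (2*i+1 :: nat) :: 'a::comm_monoid_mult)"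
  by (induction r) (auto simp: mult_ac)

lemma sum_pairs: "(\<Sum>j<2*r. h j) = (\<Sum>i<r. h (2*i) + h (2*i+1 :: nat) :: 'a::comm_monoid_add)"
  by (induction r) (auto simp: add_ac)

text \<open>
  The summand of one permutation. It does not change when two pairs of positions are exchanged or,
  for an alternating matrix, when the two entries of a pair are exchanged; hence the
  normalization by \<open>2\<^sup>r r!\<close>.
\<close>

definition pfaffian_term :: "nat \<Rightarrow> (nat \<Rightarrow> nat \<Rightarrow> 'a::field) \<Rightarrow> (nat \<Rightarrow> nat) \<Rightarrow> 'a" where
  "pfaffian_term r A p = of_int (sign p) * (\<Prod>i<r. A (p (2*i)) (p (2*i+1)))"

lemma pfaffian_matrix_term:
  "pfaffian_matrix r A = (\<Sum>p | p permutes {..<2*r}. pfaffian_term r A p) / of_nat (2^r * fact r)"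
  by (simp add: pfaffian_matrix_def pfaffian_term_def)

lemma pfaffian_matrix_cong:
  assumes "\<And>i j. i < 2*r \<Longrightarrow> j < 2*r \<Longrightarrow> A i j = A' i j"
  shows "pfaffian_matrix r A = pfaffian_matrix r A'"
proof -
  have "(\<Prod>i<r. A (p (2*i)) (p (2*i+1))) = (\<Prod>i<r. A' (p (2*i)) (p (2*i+1)))"
    if "p permutes {..<2*r}" for p
  proof (rule prod.cong[OF refl])
    fix i assume "i \<in> {..<r}"
    hence "2*i \<in> {..<2*r}" "2*i+1 \<in> {..<2*r}" by auto
    hence "p (2*i) \<in> {..<2*r}" "p (2*i+1) \<in> {..<2*r}"
      using permutes_in_image[OF that] by blast+
    thus "A (p (2*i)) (p (2*i+1)) = A' (p (2*i)) (p (2*i+1))" using assms by simp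
  qed
  thus ?thesis unfolding pfaffian_matrix_def by (intro arg_cong2[where f="(/)"] sum.cong refl) (simp only: mem_Collect_eq)
qed

lemma pfaffian_matrix_scale:
  "pfaffian_matrix r (\<lambda>i j. c * A i j) = c ^ r * pfaffian_matrix r A"
  by (simp add: pfaffian_matrix_def prod.distrib sum_distrib_left mult_ac)

lemma permutes_lessThanD: "p permutes {..<N::nat} \<Longrightarrow> j < N \<Longrightarrow> p j < N"
  using permutes_in_image[of p "{..<N}" j] by simp

text \<open>
  The sum is the determinant of \<open>B\<close> with its columns selected by \<open>f\<close>. It vanishes if a column is
  repeated, and it is the determinant of \<open>B\<close> up to sign if the columns are permuted.
\<close>

lemma sum_sign_prod_eq_0_if_not_inj:
  fixes B :: "nat \<Rightarrow> nat \<Rightarrow> 'a::field"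
  assumes "\<not> inj_on f {..<N}"
  shows "(\<Sum>p | p permutes {..<N}. of_int (sign p) * (\<Prod>j<N. B (p j) (f j))) = 0"
proof -
  obtain k l where kl: "k < N" "l < N" "k \<noteq> l" "f k = f l" using assms by (auto simp: inj_on_def)
  let ?C = "Matrix.mat N N (\<lambda>(j, i). B i (f j))"
  have "Matrix.row ?C k = Matrix.row ?C l" using kl by (intro Matrix.eq_vecI) auto
  hence "Determinant.det ?C = 0"
    using kl det_identical_rows[of ?C N k l] by auto
  moreover have "Determinant.det ?C = (\<Sum>p | p permutes {..<N}. of_int (sign p) * (\<Prod>j<N. B (p j) (f j)))"
    unfolding det_def'[of ?C N, simplified] lessThan_atLeast0
    by (intro sum.cong refl arg_cong2[where f="(*)"] prod.cong)
  ultimately show ?thesis by simp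
qed

lemma sum_sign_prod_permutes:
  fixes B :: "nat \<Rightarrow> nat \<Rightarrow> 'a::field"
  assumes f: "f permutes {..<N}"
  shows "(\<Sum>p | p permutes {..<N}. of_int (sign p) * (\<Prod>j<N. B (p j) (f j))) =
         of_int (sign f) * Determinant.det (Matrix.mat N N (\<lambda>(i, j). B i j))"
proof -
  let ?C = "Matrix.mat N N (\<lambda>(j, i). B i j)"
  have T: "Determinant.det ?C = Determinant.det (Matrix.mat N N (\<lambda>(i, j). B i j))"
    by (subst Determinant.det_transpose[symmetric, of _ N])
       (auto intro!: arg_cong[where f=Determinant.det] Matrix.eq_matI)
  have "Determinant.det (Matrix.mat N N (\<lambda>(i,j). ?C $$ (f i, j))) = of_int (sign f) * Determinant.det ?C"
    using f by (subst det_permute_rows[of _ N]) (auto simp: lessThan_atLeast0)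
  moreover have "Determinant.det (Matrix.mat N N (\<lambda>(i,j). ?C $$ (f i, j))) =
     (\<Sum>p | p permutes {..<N}. of_int (sign p) * (\<Prod>j<N. B (p j) (f j)))"
    using f unfolding det_def'[of "Matrix.mat N N _" N, simplified] lessThan_atLeast0
    by (intro sum.cong refl arg_cong2[where f="(*)"] prod.cong)
       (auto dest: permutes_lessThanD[unfolded lessThan_atLeast0])
  ultimately show ?thesis using T by simp
qed

text \<open>
  \<open>Pf (B A B\<^sup>T) = det B Pf A\<close>: expanding all the products of sums gives one term for each choice of
  column indices \<open>g\<close>, with a determinant of selected columns of \<open>B\<close> as its coefficient. Only the choices
  that form a permutation survive, and they reassemble to the Pfaffian of \<open>A\<close>.
\<close>

theorem pfaffian_matrix_congruence:
  fixes A B :: "nat \<Rightarrow> nat \<Rightarrow> 'a::field"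
  shows "pfaffian_matrix r (\<lambda>i j. \<Sum>k<2*r. \<Sum>l<2*r. B i k * A k l * B j l) =
         Determinant.det (Matrix.mat (2*r) (2*r) (\<lambda>(i, j). B i j)) * pfaffian_matrix r A"
proof -
  let ?N = "2*r" and ?U = "{..<2*r}"
  let ?G = "{..<r} \<rightarrow>\<^sub>E ?U \<times> ?U"
  \<comment> \<open>a choice of one index pair for each factor, read as a selection of \<open>2 r\<close> columns\<close>
  define f :: "(nat \<Rightarrow> nat \<times> nat) \<Rightarrow> nat \<Rightarrow> nat"
    where "f g j = (if j < ?N then if even j then fst (g (j div 2)) else snd (g (j div 2)) else j)" for g j
  have f_range: "f g j \<in> ?U" if "g \<in> ?G" "j < ?N" for g j
  proof -
    have "j div 2 < r" using that by auto
    hence "g (j div 2) \<in> ?U \<times> ?U" using that(1) by (intro PiE_mem[of g]) auto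
    thus ?thesis using that(2) by (simp add: f_def mem_Times_iff)
  qed
  define D where "D h = (\<Sum>p | p permutes ?U. of_int (sign p) * (\<Prod>j<?N. B (p j) (h j)))" for h
  have D_perm: "D h = of_int (sign h) * Determinant.det (Matrix.mat ?N ?N (\<lambda>(i, j). B i j))"
    if "h permutes ?U" for h
    using sum_sign_prod_permutes[OF that, of B] by (simp add: D_def)
  have "(\<Sum>p | p permutes ?U. of_int (sign p) *
          (\<Prod>i<r. \<Sum>k<?N. \<Sum>l<?N. B (p (2*i)) k * A k l * B (p (2*i+1)) l)) =
        (\<Sum>p | p permutes ?U. of_int (sign p) * (\<Sum>g\<in>?G. \<Prod>i<r.
           B (p (2*i)) (fst (g i)) * A (fst (g i)) (snd (g i)) * B (p (2*i+1)) (snd (g i))))"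
  proof (rule sum.cong[OF refl])
    fix p :: "nat \<Rightarrow> nat"
    have eq: "(\<Sum>k<?N. \<Sum>l<?N. B (p (2*i)) k * A k l * B (p (2*i+1)) l) =
      (\<Sum>y\<in>?U\<times>?U. B (p (2*i)) (fst y) * A (fst y) (snd y) * B (p (2*i+1)) (snd y))" for i :: nat
      unfolding sum.cartesian_product case_prod_unfold ..
    have "(\<Prod>i<r. \<Sum>k<?N. \<Sum>l<?N. B (p (2*i)) k * A k l * B (p (2*i+1)) l) =
      (\<Prod>i<r. \<Sum>y\<in>?U\<times>?U. B (p (2*i)) (fst y) * A (fst y) (snd y) * B (p (2*i+1)) (snd y))"
      by (simp only: eq)
    also have "\<dots> = (\<Sum>g\<in>?G. \<Prod>i<r.
        B (p (2*i)) (fst (g i)) * A (fst (g i)) (snd (g i)) * B (p (2*i+1)) (snd (g i)))"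
      by (rule prod_sum_PiE) auto
    finally show "of_int (sign p) * (\<Prod>i<r. \<Sum>k<?N. \<Sum>l<?N. B (p (2*i)) k * A k l * B (p (2*i+1)) l) =
        of_int (sign p) * (\<Sum>g\<in>?G. \<Prod>i<r.
          B (p (2*i)) (fst (g i)) * A (fst (g i)) (snd (g i)) * B (p (2*i+1)) (snd (g i)))"
      by (rule arg_cong)
  qed
  also have "\<dots> = (\<Sum>g\<in>?G. (\<Prod>i<r. A (fst (g i)) (snd (g i))) * D (f g))"
  proof -
    have "(\<Prod>i<r. B (p (2*i)) (fst (g i)) * A (fst (g i)) (snd (g i)) * B (p (2*i+1)) (snd (g i))) =
          (\<Prod>i<r. A (fst (g i)) (snd (g i))) * (\<Prod>j<?N. B (p j) (f g j))" for p g
      unfolding prod_pairs prod.distrib[symmetric]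
      by (rule prod.cong) (auto simp: f_def mult_ac)
    thus ?thesis
      unfolding D_def sum_distrib_left by (subst sum.swap) (simp add: mult_ac)
  qed
  also have "\<dots> = (\<Sum>g\<in>{g\<in>?G. inj_on (f g) ?U}. (\<Prod>i<r. A (fst (g i)) (snd (g i))) * D (f g))"
    by (rule sum.mono_neutral_right) (auto simp: finite_PiE D_def sum_sign_prod_eq_0_if_not_inj)
  also have "\<dots> = (\<Sum>p | p permutes ?U. (\<Prod>i<r. A (p (2*i)) (p (2*i+1))) * D p)"
  proof (rule sum.reindex_bij_witness[of _ "\<lambda>p. \<lambda>i\<in>{..<r}. (p (2*i), p (2*i+1))" f])
    fix g assume g: "g \<in> {g\<in>?G. inj_on (f g) ?U}"
    show "(\<lambda>i\<in>{..<r}. (f g (2*i), f g (2*i+1))) = g"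
      using g by (intro ext) (auto simp: f_def restrict_def PiE_def extensional_def)
    have "f g ` ?U \<subseteq> ?U" using f_range g by blast
    hence "bij_betw (f g) ?U ?U"
      using g endo_inj_surj[of ?U "f g"] by (simp add: bij_betw_def)
    thus "f g \<in> {p. p permutes ?U}"
      by (auto intro!: bij_imp_permutes simp: f_def split: if_splits)
    show "(\<Prod>i<r. A (f g (2*i)) (f g (2*i+1))) * D (f g) = (\<Prod>i<r. A (fst (g i)) (snd (g i))) * D (f g)"
      by (intro arg_cong2[where f="(*)"] prod.cong) (auto simp: f_def)
  next
    fix p assume p: "p \<in> {p. p permutes ?U}"
    hence img: "p j < ?N" if "j < ?N" for j using that permutes_in_image[of p ?U j] by simp
    have "even j \<Longrightarrow> 2 * (j div 2) = j" "odd j \<Longrightarrow> Suc (2 * (j div 2)) = j" for j :: nat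
      by auto
    moreover have "p j = j" if "\<not> j < ?N" for j using p that by (auto simp: permutes_def)
    ultimately show fp: "f (\<lambda>i\<in>{..<r}. (p (2*i), p (2*i+1))) = p"
      by (intro ext) (auto simp: f_def)
    have "inj_on p ?U" using p by (auto intro: permutes_inj_on)
    with img show "(\<lambda>i\<in>{..<r}. (p (2*i), p (2*i+1))) \<in> {g\<in>?G. inj_on (f g) ?U}"
      unfolding mem_Collect_eq fp by auto
  qed
  also have "\<dots> = Determinant.det (Matrix.mat ?N ?N (\<lambda>(i, j). B i j)) *
      (\<Sum>p | p permutes ?U. of_int (sign p) * (\<Prod>i<r. A (p (2*i)) (p (2*i+1))))"
    by (simp add: sum_distrib_left D_perm mult_ac)
  finally show ?thesis by (simp add: pfaffian_matrix_def)
qed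

text \<open>
  Composition with an involution on the right matches the permutations that take \<open>\<sigma> j\<close> to \<open>t\<close> with
  those that take \<open>j\<close> to \<open>t\<close>.
\<close>

lemma sum_permutes_comp:
  assumes \<sigma>: "\<sigma> permutes S" "\<sigma> \<circ> \<sigma> = id" and F: "\<And>p. p permutes S \<Longrightarrow> F (p \<circ> \<sigma>) = F p"
  shows "(\<Sum>p | p permutes S \<and> p (\<sigma> j) = t. F p) = (\<Sum>p | p permutes S \<and> p j = t. F p)"
proof (rule sum.reindex_bij_witness[of _ "\<lambda>p. p \<circ> \<sigma>" "\<lambda>p. p \<circ> \<sigma>"])
  have "\<sigma> (\<sigma> x) = x" for x using \<sigma>(2) by (metis comp_apply id_apply)
  note [simp] = this
  show "(p \<circ> \<sigma>) \<circ> \<sigma> = p" for p :: "'a \<Rightarrow> 'a" by (simp add: fun_eq_iff)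
  thus "(p \<circ> \<sigma>) \<circ> \<sigma> = p" for p :: "'a \<Rightarrow> 'a" .
  show "p \<circ> \<sigma> \<in> {p. p permutes S \<and> p (\<sigma> j) = t}" if "p \<in> {p. p permutes S \<and> p j = t}" for p
    using that \<sigma>(1) by (auto intro: permutes_compose)
  show "p \<circ> \<sigma> \<in> {p. p permutes S \<and> p j = t}" if "p \<in> {p. p permutes S \<and> p (\<sigma> j) = t}" for p
    using that \<sigma>(1) by (auto intro: permutes_compose)
  show "F (p \<circ> \<sigma>) = F p" if "p \<in> {p. p permutes S \<and> p (\<sigma> j) = t}" for p
    using that F by auto
qed

lemma sign_comp_transpose:
  assumes "p permutes {..<N::nat}" "a \<noteq> b"
  shows "sign (p \<circ> Transposition.transpose a b) = - sign p"
proof -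
  have "permutation p" using assms(1) by (auto simp: permutation_permutes)
  thus ?thesis using assms(2) by (simp add: sign_compose permutation_swap_id sign_swap_id)
qed

lemma pfaffian_term_swap_in_pair:
  assumes "p permutes {..<2*r}" "i < r"
    and A: "\<And>i j. i < 2*r \<Longrightarrow> j < 2*r \<Longrightarrow> A i j = - A j i"
  shows "pfaffian_term r A (p \<circ> Transposition.transpose (2*i) (2*i+1)) = pfaffian_term r A p"
proof -
  let ?\<sigma> = "Transposition.transpose (2*i) (2*i+1)"
  let ?F = "\<lambda>p k. A (p (2*k)) (p (2*k+1))"
  have img: "p j < 2*r" if "j < 2*r" for j using that permutes_in_image[OF assms(1), of j] by simp
  have "?\<sigma> (2*k) = 2*k \<and> ?\<sigma> (2*k+1) = 2*k+1" if "k \<noteq> i" for k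
    using that by (auto simp: Transposition.transpose_def)
  hence "(\<Prod>k\<in>{..<r}-{i}. ?F (p \<circ> ?\<sigma>) k) = (\<Prod>k\<in>{..<r}-{i}. ?F p k)"
    by (intro prod.cong) auto
  moreover have "?F (p \<circ> ?\<sigma>) i = - ?F p i"
    using A[OF img img, of "2*i+1" "2*i"] \<open>i < r\<close> by simp
  ultimately have "(\<Prod>k<r. ?F (p \<circ> ?\<sigma>) k) = - (\<Prod>k<r. ?F p k)"
    using \<open>i < r\<close> by (simp only: prod.remove[of "{..<r}" i] finite_lessThan lessThan_iff)  simp
  thus ?thesis
    using sign_comp_transpose[OF assms(1), of "2*i" "2*i+1"] by (simp add: pfaffian_term_def)
qed

lemma pfaffian_term_swap_pairs:
  assumes "p permutes {..<2*r}" "i < r" "j < r"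
  shows "pfaffian_term r A (p \<circ> (Transposition.transpose (2*i) (2*j) \<circ> Transposition.transpose (2*i+1) (2*j+1))) = pfaffian_term r A p"
proof (cases "i = j")
  case False
  let ?\<sigma> = "Transposition.transpose (2*i) (2*j) \<circ> Transposition.transpose (2*i+1) (2*j+1)"
  have \<sigma>: "?\<sigma> (2*k) = 2 * Transposition.transpose i j k" "?\<sigma> (2*k+1) = 2 * Transposition.transpose i j k + 1" for k
    by (auto simp: Transposition.transpose_def)
  have "(\<Prod>k<r. A ((p \<circ> ?\<sigma>) (2*k)) ((p \<circ> ?\<sigma>) (2*k+1))) =
        (\<Prod>k<r. A (p (2 * Transposition.transpose i j k)) (p (2 * Transposition.transpose i j k + 1)))"
    unfolding comp_apply[of p] \<sigma> ..
  also have "\<dots> = (\<Prod>k<r. A (p (2*k)) (p (2*k+1)))"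
    using assms prod.permute[of "Transposition.transpose i j" "{..<r}" "\<lambda>k. A (p (2*k)) (p (2*k+1))"]
    by (auto simp: comp_def permutes_swap_id)
  moreover have "sign (p \<circ> ?\<sigma>) = sign p"
  proof -
    have "p \<circ> Transposition.transpose (2*i) (2*j) permutes {..<2*r}"
      using assms by (intro permutes_compose permutes_swap_id) auto
    hence "sign (p \<circ> Transposition.transpose (2*i) (2*j) \<circ> Transposition.transpose (2*i+1) (2*j+1)) = sign p"
      using False sign_comp_transpose[OF assms(1), of "2*i" "2*j"]
      by (subst sign_comp_transpose) auto
    thus ?thesis by (simp add: comp_assoc)
  qed
  ultimately show ?thesis by (simp add: pfaffian_term_def)
qed auto

text \<open>
  Sort the permutations by the position \<open>j\<close> at which the index \<open>2 r\<close> occurs. By the two symmetries of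
  \<open>pfaffian_term\<close> all \<open>2 r + 2\<close> positions contribute equally. At the position \<open>2 r\<close> only the permutations
  that also fix \<open>2 r + 1\<close> survive, and they restrict to permutations of the smaller set.
\<close>

theorem pfaffian_matrix_direct_sum:
  fixes A :: "nat \<Rightarrow> nat \<Rightarrow> 'a::field_char_0"
  assumes A: "\<And>i j. i < 2*r+2 \<Longrightarrow> j < 2*r+2 \<Longrightarrow> A i j = - A j i"
    and 0: "\<And>i. i < 2*r \<Longrightarrow> A (2*r) i = 0"
  shows "pfaffian_matrix (Suc r) A = A (2*r) (2*r+1) * pfaffian_matrix r A"
proof -
  let ?U = "{..<2 * Suc r}" and ?T = "pfaffian_term (Suc r) A"
  define S where "S j = (\<Sum>p | p permutes ?U \<and> p j = 2*r. ?T p)" for j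
  have even_case: "S (2*i) = S (2*r)" if "i < Suc r" for i
  proof -
    let ?\<sigma> = "Transposition.transpose (2*i) (2*r) \<circ> Transposition.transpose (2*i+1) (2*r+1)"
    have "?\<sigma> permutes ?U"
      using that by (intro permutes_compose permutes_swap_id) auto
    moreover have "?\<sigma> \<circ> ?\<sigma> = id"
      by (auto simp: Transposition.transpose_def fun_eq_iff; presburger)
    moreover have "?T (p \<circ> ?\<sigma>) = ?T p" if "p permutes ?U" for p
      using that \<open>i < Suc r\<close> by (intro pfaffian_term_swap_pairs) auto
    ultimately have "(\<Sum>p | p permutes ?U \<and> p (?\<sigma> (2*r)) = 2*r. ?T p) = S (2*r)"
      unfolding S_def by (rule sum_permutes_comp)
    moreover have "2*r \<noteq> Suc (2*i)" by presburger
    hence "?\<sigma> (2*r) = 2*i" by (simp add: Transposition.transpose_def)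
    ultimately show ?thesis by (simp add: S_def)
  qed
  have odd_case: "S (2*i+1) = S (2*i)" if "i < Suc r" for i
  proof -
    let ?\<sigma> = "Transposition.transpose (2*i) (2*i+1)"
    have "?\<sigma> permutes ?U" using that by (intro permutes_swap_id) auto
    moreover have "?\<sigma> \<circ> ?\<sigma> = id" by simp
    moreover have "?T (p \<circ> ?\<sigma>) = ?T p" if "p permutes ?U" for p
      using that \<open>i < Suc r\<close> by (intro pfaffian_term_swap_in_pair A) auto
    ultimately have "(\<Sum>p | p permutes ?U \<and> p (?\<sigma> (2*i)) = 2*r. ?T p) = S (2*i)"
      unfolding S_def by (rule sum_permutes_comp)
    thus ?thesis by (simp add: S_def)
  qed
  have S_last: "S (2*r) = A (2*r) (2*r+1) * (\<Sum>p | p permutes {..<2*r}. pfaffian_term r A p)"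
  proof -
    have "S (2*r) = (\<Sum>p | p permutes ?U \<and> p (2*r) = 2*r \<and> p (2*r+1) = 2*r+1. ?T p)"
      unfolding S_def
    proof (rule sum.mono_neutral_right)
      show "\<forall>p\<in>{p. p permutes ?U \<and> p (2*r) = 2*r} -
              {p. p permutes ?U \<and> p (2*r) = 2*r \<and> p (2*r+1) = 2*r+1}. ?T p = 0"
      proof
        fix p assume p: "p \<in> {p. p permutes ?U \<and> p (2*r) = 2*r} -
              {p. p permutes ?U \<and> p (2*r) = 2*r \<and> p (2*r+1) = 2*r+1}"
        have "p (2*r+1) \<in> ?U" using p permutes_in_image[of p ?U "2*r+1"] by auto
        moreover have "p (2*r+1) \<noteq> p (2*r)" using p permutes_inj[of p ?U] inj_eq[of p "2*r+1" "2*r"] by auto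
        ultimately have "p (2*r+1) < 2*r" using p by auto
        hence "A (p (2*r)) (p (2*r+1)) = 0" using p 0 by auto
        thus "?T p = 0" by (simp add: pfaffian_term_def)
      qed
    qed (auto simp: finite_permutations)
    also have "{p. p permutes ?U \<and> p (2*r) = 2*r \<and> p (2*r+1) = 2*r+1} = {p. p permutes {..<2*r}}"
    proof (intro Set.set_eqI iffI)
      fix p assume p: "p \<in> {p. p permutes ?U \<and> p (2*r) = 2*r \<and> p (2*r+1) = 2*r+1}"
      have "p x = x" if "x \<in> ?U - {..<2*r}" for x
      proof -
        have "x = 2*r \<or> x = 2*r+1" using that by auto
        thus ?thesis using p by auto
      qed
      thus "p \<in> {p. p permutes {..<2*r}}" 
        using p permutes_superset[of p ?U "{..<2*r}"] by blast
    next
      fix p assume p: "p \<in> {p. p permutes {..<2*r}}"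
      hence "p permutes ?U" by (auto intro: permutes_subset)
      moreover have "p (2*r) = 2*r" "p (2*r+1) = 2*r+1"
        using p by (auto intro!: permutes_not_in[of p "{..<2*r}"])
      ultimately show "p \<in> {p. p permutes ?U \<and> p (2*r) = 2*r \<and> p (2*r+1) = 2*r+1}" by auto
    qed
    also have "(\<Sum>p | p permutes {..<2*r}. ?T p) =
        (\<Sum>p | p permutes {..<2*r}. A (2*r) (2*r+1) * pfaffian_term r A p)"
    proof (rule sum.cong[OF refl])
      fix p assume p: "p \<in> {p. p permutes {..<2*r}}"
      have "p (2*r) = 2*r" "p (2*r+1) = 2*r+1"
        using p by (auto intro!: permutes_not_in[of p "{..<2*r}"])
      thus "?T p = A (2*r) (2*r+1) * pfaffian_term r A p" by (simp add: pfaffian_term_def)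
    qed
    finally show ?thesis by (simp add: sum_distrib_left)
  qed
  have "(\<Sum>p | p permutes ?U. ?T p) = (\<Sum>j\<in>?U. \<Sum>p\<in>{p\<in>{p. p permutes ?U}. inv_into UNIV p (2*r) = j}. ?T p)"
  proof (rule sum.group[symmetric])
    show "finite {p. p permutes ?U}" by (simp add: finite_permutations)
    show "(\<lambda>p. inv_into UNIV p (2*r)) ` {p. p permutes ?U} \<subseteq> ?U"
      using permutes_in_image[OF permutes_inv] by fastforce
  qed simp
  also have "\<dots> = (\<Sum>j\<in>?U. S j)"
    unfolding S_def
    by (intro sum.cong refl Set.set_eqI) (auto simp: permutes_inv_eq)
  also have "\<dots> = (\<Sum>i<Suc r. S (2*i) + S (2*i+1))" by (rule sum_pairs)
  also have "\<dots> = (\<Sum>i<Suc r. 2 * S (2*r))"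
  proof (rule sum.cong[OF refl])
    fix i assume "i \<in> {..<Suc r}"
    hence "i < Suc r" by simp
    thus "S (2*i) + S (2*i+1) = 2 * S (2*r)"
      unfolding odd_case[OF \<open>i < Suc r\<close>] even_case[OF \<open>i < Suc r\<close>] by simp
  qed
  also have "\<dots> = of_nat (2 * Suc r) * S (2*r)" by simp
  finally have "(\<Sum>p | p permutes ?U. ?T p) = of_nat (2 * Suc r) * S (2*r)" .
  moreover have "of_nat (2 ^ Suc r * fact (Suc r)) = (of_nat (2 * Suc r) * of_nat (2 ^ r * fact r) :: 'a)"
    unfolding of_nat_mult[symmetric] by (simp add: algebra_simps)
  moreover have "of_nat (2 * Suc r) \<noteq> (0 :: 'a)" by (simp del: of_nat_Suc of_nat_mult)
  ultimately show ?thesis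
    unfolding pfaffian_matrix_term S_last 
    by (simp only: times_divide_eq_right mult_divide_mult_cancel_left simp_thms)
qed

text \<open>
  Elimination with a \<open>2 \<times> 2\<close> pivot block in the last two rows and columns: adding multiples of these rows
  (and columns) to the others is a congruence with a unitriangular matrix, and it leaves the direct sum
  of the Schur complement and the pivot block.
\<close>

theorem pfaffian_matrix_pivot:
  fixes A :: "nat \<Rightarrow> nat \<Rightarrow> 'a::field_char_0"
  assumes A: "\<And>i j. i < 2*r+2 \<Longrightarrow> j < 2*r+2 \<Longrightarrow> A i j = - A j i"
    and d: "A (2*r) (2*r+1) \<noteq> 0"
  shows "pfaffian_matrix (Suc r) A = A (2*r) (2*r+1) * pfaffian_matrix r
     (\<lambda>i j. A i j + (A i (2*r) * A (2*r+1) j - A i (2*r+1) * A (2*r) j) / A (2*r) (2*r+1))"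
proof -
  define p q where "p = 2*r" and "q = 2*r+1"
  define d where "d = A p q"
  let ?N = "2 * Suc r"
  define B where "B i k = (if k = i then 1 else 0) +
      (if i < p \<and> k = q then A i p / d else 0) - (if i < p \<and> k = p then A i q / d else 0)" for i k
  define A' where "A' i j = (if i < p \<and> j < p then A i j + (A i p * A q j - A i q * A p j) / d
      else if i < p \<or> j < p then 0 else A i j)" for i j
  have d0: "d \<noteq> 0" using d by (simp add: d_def p_def q_def)
  have anti: "A i j = - A j i" if "i < ?N" "j < ?N" for i j
    using A[of i j] that by simp
  have diag: "A i i = 0" if "i < ?N" for i
    using anti[OF that that] by (simp add: equal_neg_zero)
  have pq: "p < ?N" "q < ?N" "p \<noteq> q" by (auto simp: p_def q_def)
  have Apq: "A p q = d" "A q p = - d" using anti[of q p] pq by (auto simp: d_def)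
  have split: "(\<Sum>k<?N. B i k * f k) = (if i < p then f i + A i p / d * f q - A i q / d * f p else f i)"
    if "i < ?N" for i f
    using that pq by (auto simp: B_def distrib_right left_diff_distrib sum.distrib sum_subtractf if_distrib[where f="\<lambda>x. x * _"] cong: if_cong)
  have cong: "(\<Sum>k<?N. \<Sum>l<?N. B i k * A k l * B j l) = A' i j" if ij: "i < ?N" "j < ?N" for i j
  proof -
    have "(\<Sum>k<?N. \<Sum>l<?N. B i k * A k l * B j l) = (\<Sum>k<?N. B i k * (\<Sum>l<?N. B j l * A k l))"
      by (intro sum.cong refl) (simp only: sum_distrib_left mult_ac)
    also have "\<dots> = A' i j"
    proof -
      have "i < p \<or> i = p \<or> i = q" "j < p \<or> j = p \<or> j = q"
        using ij by (auto simp: p_def q_def)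
      moreover have "\<not> q < p" by (simp add: p_def q_def)
      moreover have "A p j = - A j p" "A q j = - A j q" "A p p = 0" "A q q = 0"
        using anti[of p j] anti[of q j] ij pq diag by auto
      ultimately show ?thesis
        unfolding split[OF ij(1)] split[OF ij(2)] A'_def using d0 Apq
        by (elim disjE) (simp_all add: field_simps)
    qed
    finally show ?thesis .
  qed
  have det: "Determinant.det (Matrix.mat ?N ?N (\<lambda>(i, j). B i j)) = 1"
  proof (subst det_upper_triangular)
    show "upper_triangular (Matrix.mat ?N ?N (\<lambda>(i, j). B i j))"
      by (auto simp: upper_triangular_def B_def p_def q_def)
    have "map (\<lambda>i. Matrix.mat ?N ?N (\<lambda>(i, j). B i j) $$ (i, i)) [0..<?N] = map (\<lambda>i. 1) [0..<?N]"
      by (intro map_cong refl) (auto simp: B_def p_def q_def)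
    thus "prod_list (diag_mat (Matrix.mat ?N ?N (\<lambda>(i, j). B i j))) = 1"
      unfolding diag_mat_def by (simp add: map_replicate_const del: upt_Suc)
  qed auto
  have "pfaffian_matrix (Suc r) A = pfaffian_matrix (Suc r) (\<lambda>i j. \<Sum>k<?N. \<Sum>l<?N. B i k * A k l * B j l)"
    by (subst pfaffian_matrix_congruence) (simp only: det mult_1_left)
  also have "\<dots> = pfaffian_matrix (Suc r) A'"
    using cong by (rule pfaffian_matrix_cong)
  also have "\<dots> = A' p q * pfaffian_matrix r A'"
    unfolding p_def q_def
  proof (rule pfaffian_matrix_direct_sum)
    show "A' (2*r) i = 0" if "i < 2*r" for i using that by (simp add: A'_def p_def)
    show "A' i j = - A' j i" if "i < 2*r+2" "j < 2*r+2" for i j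
    proof -
      have *: "A i j = - A j i" "A i p = - A p i" "A j q = - A q j" "A i q = - A q i" "A j p = - A p j"
        using that pq by (intro anti; simp)+
      show ?thesis unfolding A'_def * using d0 by (simp add: field_simps)
    qed
  qed
  also have "pfaffian_matrix r A' = pfaffian_matrix r (\<lambda>i j. A i j + (A i p * A q j - A i q * A p j) / d)"
    by (rule pfaffian_matrix_cong) (simp add: A'_def p_def)
  also have "A' p q = d" by (simp add: A'_def p_def q_def d_def)
  finally show ?thesis by (simp add: d_def p_def q_def)
qed

lemma pfaffian_matrix_0: "pfaffian_matrix 0 A = 1"
  by (simp add: pfaffian_matrix_def)

definition symplectic :: "nat \<Rightarrow> nat \<Rightarrow> 'a::field" where
  "symplectic i j =
     (if even i \<and> j = Suc i then 1 else if even j \<and> i = Suc j then -1 else 0)"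

lemma symplectic_antisym: "symplectic i j = - symplectic j i"
  by (auto simp: symplectic_def)

lemma pfaffian_symplectic: "pfaffian_matrix r (symplectic :: _ \<Rightarrow> _ \<Rightarrow> 'a::field_char_0) = 1"
proof (induction r)
  case (Suc r)
  have "pfaffian_matrix (Suc r) symplectic =
      (symplectic (2*r) (2*r+1) :: 'a) * pfaffian_matrix r symplectic"
  proof (rule pfaffian_matrix_direct_sum)
    show "symplectic i j = - (symplectic j i :: 'a)" for i j
      by (rule symplectic_antisym)
    have "2*r \<noteq> Suc i" if "even i" for i using that by presburger
    thus "symplectic (2*r) i = (0 :: 'a)" if "i < 2*r" for i
      using that by (simp add: symplectic_def)
  qed
  moreover have "symplectic (2*r) (2*r+1) = (1 :: 'a)" by (simp add: symplectic_def)
  ultimately show ?case by (simp only: Suc mult_1_right)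
qed (rule pfaffian_matrix_0)

section \<open>Feynman parametrization\<close>

interpretation lborel_product: product_sigma_finite "\<lambda>_. lborel" ..

lemma nn_integral_inverse_power_atLeast_0:
  fixes P R :: real
  assumes "P > 0" "R > 0" "k > 0"
  shows "(\<integral>\<^sup>+ t. ennreal (1 / (t * P + R) ^ Suc k) * indicator {0..} t \<partial>lborel) = ennreal (1 / (real k * P * R ^ k))"
proof -
  let ?F = "\<lambda>t. - (1 / (real k * P * (t * P + R) ^ k))"
  have pos: "t * P + R > 0" if "t \<ge> 0" for t using assms that by (simp add: add_nonneg_pos)
  have "(\<integral>\<^sup>+ t. ennreal (1 / (t * P + R) ^ Suc k) * indicator {0..} t \<partial>lborel) = ennreal (0 - ?F 0)"
  proof (rule nn_integral_FTC_atLeast)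
    fix t :: real assume t: "0 \<le> t"
    have "((\<lambda>t. - (1 / (real k * P)) * inverse ((t * P + R) ^ k)) has_real_derivative
        - (1 / (real k * P)) * - (inverse ((t * P + R) ^ k) * (real k * (t * P + R) ^ (k - 1) * P) * inverse ((t * P + R) ^ k))) (at t)"
      using pos[OF t] by (auto intro!: derivative_eq_intros)
    moreover have "- (1 / (real k * P)) * - (inverse ((t * P + R) ^ k) * (real k * (t * P + R) ^ (k - 1) * P) * inverse ((t * P + R) ^ k))
        = 1 / (t * P + R) ^ Suc k"
    proof -
      obtain j where "k = Suc j" using assms(3) by (cases k) auto
      moreover define X where "X = t * P + R"
      ultimately show ?thesis using pos[OF t] assms by (simp add: X_def[symmetric] divide_simps)
    qed
    ultimately show "(?F has_real_derivative 1 / (t * P + R) ^ Suc k) (at t)"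
      by (simp add: field_simps)
    show "0 \<le> 1 / (t * P + R) ^ Suc k" using pos[OF t] by simp
  next
    have "filterlim (\<lambda>t. R + P * t) at_top at_top"
      using assms by (intro filterlim_tendsto_add_at_top[OF tendsto_const]
          filterlim_tendsto_pos_mult_at_top[OF tendsto_const _ filterlim_ident])
    hence "filterlim (\<lambda>t. (R + P * t) ^ k) at_top at_top"
      using assms by (intro filterlim_pow_at_top) auto
    hence "((\<lambda>t. inverse ((R + P * t) ^ k)) \<longlongrightarrow> 0) at_top"
      by (rule tendsto_inverse_0_at_top)
    hence "((\<lambda>t. - (1 / (real k * P)) * inverse ((R + P * t) ^ k)) \<longlongrightarrow> - (1 / (real k * P)) * 0) at_top"
      by (intro tendsto_intros)
    thus "(?F \<longlongrightarrow> 0) at_top" by (simp add: field_simps)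
  qed simp
  thus ?thesis by simp
qed

lemma affine_delta_Suc: "indicator (affine_delta (Suc d)) (a(d := y)) =
    (indicator (affine_delta d) a * indicator {0..} y :: ennreal)"
  by (auto simp: affine_delta_def indicator_def less_Suc_eq)

lemma affine_delta_measurable [measurable]:
  "affine_delta d \<inter> space (\<Pi>\<^sub>M i\<in>{..<d}. lborel) \<in> sets (\<Pi>\<^sub>M i\<in>{..<d}. lborel)"
proof -
  have "affine_delta d \<inter> space (\<Pi>\<^sub>M i\<in>{..<d}. lborel) = (\<Pi>\<^sub>E i\<in>{..<d}. {0..})"
    by (auto simp: affine_delta_def space_PiM PiE_iff)
  thus ?thesis by (auto intro!: sets_PiM_I_finite)
qed

lemma affine_delta_pred [measurable]:
  "Measurable.pred (\<Pi>\<^sub>M i\<in>{..<d}. lborel) (\<lambda>a. a \<in> affine_delta d)"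
  using affine_delta_measurable[of d] by (simp add: pred_def Int_def conj_commute)

text \<open>
  In the affine chart the last parameter is 1, and its propagator is the constant term \<open>R\<close>.
  Integrating out one parameter at a time lowers the exponent by one and splits off one
  factor \<open>1 / P i\<close>.
\<close>

theorem feynman_parametrization:
  fixes P :: "nat \<Rightarrow> real"
  assumes "\<And>i. i < d \<Longrightarrow> P i > 0" "R > 0"
  shows "(\<integral>\<^sup>+ a. ennreal (1 / ((\<Sum>i<d. a i * P i) + R) ^ Suc d) * indicator (affine_delta d) a
            \<partial>(\<Pi>\<^sub>M i\<in>{..<d}. lborel)) = ennreal (1 / (fact d * (\<Prod>i<d. P i) * R))"
  using assms(1)
proof (induction d)
  case 0
  show ?case by (simp add: PiM_empty nn_integral_count_space_finite affine_delta_def)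
next
  case (Suc d)
  let ?L = "\<lambda>d. \<Pi>\<^sub>M i\<in>{..<d}. (lborel :: real measure)"
  let ?S = "\<lambda>a. (\<Sum>i<d. a i * P i) + R"
  have pos: "?S a > 0" if "a \<in> affine_delta d" for a
    using that Suc.prems assms(2)
    by (intro add_nonneg_pos sum_nonneg mult_nonneg_nonneg) (auto simp: affine_delta_def less_imp_le)
  have "(\<integral>\<^sup>+ a. ennreal (1 / ((\<Sum>i<Suc d. a i * P i) + R) ^ Suc (Suc d)) * indicator (affine_delta (Suc d)) a \<partial>?L (Suc d))
     = (\<integral>\<^sup>+ a. \<integral>\<^sup>+ y. ennreal (1 / ((\<Sum>i<Suc d. (a(d := y)) i * P i) + R) ^ Suc (Suc d)) *
          indicator (affine_delta (Suc d)) (a(d := y)) \<partial>lborel \<partial>?L d)"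
    unfolding lessThan_Suc
    by (rule lborel_product.product_nn_integral_insert) (simp_all add: lessThan_Suc[symmetric])
  also have "\<dots> = (\<integral>\<^sup>+ a. \<integral>\<^sup>+ y. indicator (affine_delta d) a *
      (ennreal (1 / (y * P d + ?S a) ^ Suc (Suc d)) * indicator {0..} y) \<partial>lborel \<partial>?L d)"
    unfolding affine_delta_Suc by (simp add: mult_ac add_ac)
  also have "\<dots> = (\<integral>\<^sup>+ a. ennreal (1 / (real (Suc d) * P d)) *
      (ennreal (1 / ?S a ^ Suc d) * indicator (affine_delta d) a) \<partial>?L d)"
  proof (rule nn_integral_cong)
    fix a
    show "(\<integral>\<^sup>+ y. indicator (affine_delta d) a *
        (ennreal (1 / (y * P d + ?S a) ^ Suc (Suc d)) * indicator {0..} y) \<partial>lborel) =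
      ennreal (1 / (real (Suc d) * P d)) * (ennreal (1 / ?S a ^ Suc d) * indicator (affine_delta d) a)"
    proof (cases "a \<in> affine_delta d")
      case True
      show ?thesis
        using nn_integral_inverse_power_atLeast_0[OF _ pos[OF True], of "P d" "Suc d"] Suc.prems[of d] True pos[OF True]
        by (simp add: ennreal_mult[symmetric])
    qed simp
  qed
  also have "\<dots> = ennreal (1 / (real (Suc d) * P d)) * ennreal (1 / (fact d * (\<Prod>i<d. P i) * R))"
    by (subst nn_integral_cmult) (use Suc in auto)
  also have "\<dots> = ennreal (1 / (fact (Suc d) * (\<Prod>i<Suc d. P i) * R))"
  proof -
    have "P d > 0" "(\<Prod>i<d. P i) > 0" using Suc.prems by (auto intro: prod_pos)
    thus ?thesis using assms(2) by (simp add: ennreal_mult[symmetric] mult_ac del: of_nat_Suc)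
  qed
  finally show ?case .
qed

section \<open>Integration over one loop momentum\<close>

text \<open>
  The massive one-loop integral with one propagator raised to the power \<open>p\<close>. The universal constant
  is a factorial times a product of such integrals.
\<close>

definition tadpole :: "nat \<Rightarrow> ennreal" where
  "tadpole p = (\<integral>\<^sup>+ x. ennreal (1 / ((norm x)\<^sup>2 + 1) ^ p) \<partial>(lborel :: (real^4) measure))"

lemma nn_integral_lborel_affine:
  fixes t :: "'a::euclidean_space"
  assumes "c > 0" and [measurable]: "f \<in> borel_measurable borel"
  shows "(\<integral>\<^sup>+ x. f x \<partial>lborel) = ennreal (c ^ DIM('a)) * (\<integral>\<^sup>+ x. f (t + c *\<^sub>R x) \<partial>lborel)"
  using assms(1) by (subst lborel_affine[of c t]) (simp_all add: nn_integral_density nn_integral_distr nn_integral_cmult)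

text \<open>
  Translation invariance removes \<open>v\<close>, and the substitution \<open>x = sqrt (D / m) y\<close>
  has the Jacobian \<open>(D / m)\<^sup>2\<close> in dimension 4.
\<close>

lemma nn_integral_shifted_tadpole:
  fixes v :: "real^4"
  assumes "m > 0" "D > 0"
  shows "(\<integral>\<^sup>+ x. ennreal (1 / (m * (norm (x + v))\<^sup>2 + D) ^ (p + 2)) \<partial>lborel) = ennreal (1 / (m\<^sup>2 * D ^ p)) * tadpole (p + 2)"
proof -
  define c where "c = sqrt (D / m)"
  have c: "c > 0" "c\<^sup>2 = D / m" using assms by (auto simp: c_def)
  have "c ^ 4 = (D / m)\<^sup>2" using c(2) by (metis power_even_eq mult_2 numeral_Bit0)
  hence c4: "c ^ 4 = D\<^sup>2 / m\<^sup>2" by (simp add: power_divide)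
  have eq: "1 / (m * (norm (- v + c *\<^sub>R x + v))\<^sup>2 + D) ^ (p + 2) = (1 / D ^ (p + 2)) * (1 / ((norm x)\<^sup>2 + 1) ^ (p + 2))" for x
  proof -
    have "m * (norm (- v + c *\<^sub>R x + v))\<^sup>2 + D = D * ((norm x)\<^sup>2 + 1)"
      using assms by (simp add: power_mult_distrib c field_simps)
    thus ?thesis by (simp add: power_mult_distrib)
  qed
  have "(\<integral>\<^sup>+ x. ennreal (1 / (m * (norm (x + v))\<^sup>2 + D) ^ (p + 2)) \<partial>lborel) =
      ennreal (c ^ 4) * (\<integral>\<^sup>+ x. ennreal (1 / (m * (norm (- v + c *\<^sub>R x + v))\<^sup>2 + D) ^ (p + 2)) \<partial>(lborel :: (real^4) measure))"
    using c by (subst nn_integral_lborel_affine[of c _ "- v"]) auto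
  also have "\<dots> = ennreal (c ^ 4) * (\<integral>\<^sup>+ x. ennreal (1 / D ^ (p + 2)) * ennreal (1 / ((norm x)\<^sup>2 + 1) ^ (p + 2)) \<partial>(lborel :: (real^4) measure))"
    unfolding eq using assms by (simp only: ennreal_mult' zero_le_divide_1_iff zero_le_power less_imp_le)
  also have "\<dots> = ennreal (c ^ 4) * ennreal (1 / D ^ (p + 2)) * tadpole (p + 2)"
    by (subst nn_integral_cmult) (auto simp: tadpole_def mult_ac)
  also have "ennreal (c ^ 4) * ennreal (1 / D ^ (p + 2)) = ennreal (1 / (m\<^sup>2 * D ^ p))"
    using assms by (simp add: ennreal_mult[symmetric] c4 power_add power2_eq_square field_simps)
  finally show ?thesis .
qed

lemma tadpole_pos: "tadpole p > 0"
proof -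
  have "tadpole p \<noteq> 0"
  proof
    assume "tadpole p = 0"
    hence "AE x in (lborel :: (real^4) measure). ennreal (1 / ((norm x)\<^sup>2 + 1) ^ p) = 0"
      unfolding tadpole_def by (subst (asm) nn_integral_0_iff_AE) auto
    moreover have "\<not> ennreal (1 / ((norm x)\<^sup>2 + 1) ^ p) = 0" for x :: "real^4"
    proof -
      have "(norm x)\<^sup>2 + 1 > 0" by (simp add: add_nonneg_pos)
      thus ?thesis by simp
    qed
    ultimately have "AE x in (lborel :: (real^4) measure). False" by simp
    hence "ae_filter (lborel :: (real^4) measure) = bot" by (simp add: trivial_limit_def)
    thus False by (simp add: ae_filter_eq_bot_iff)
  qed
  thus ?thesis by (simp add: zero_less_iff_neq_zero)
qed

text \<open>
  Since \<open>1 + x\<^sub>j\<^sup>2 \<le> 1 + norm x ^ 2\<close> for each of the four coordinates, the integrand is at most a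
  product of four integrands \<open>1 / (1 + t\<^sup>2)\<close> on the real line.
\<close>

lemma tadpole_finite:
  assumes "p \<ge> 4"
  shows "tadpole p < \<infinity>"
proof -
  have real_line: "(\<integral>\<^sup>+ t. ennreal (1 / (t\<^sup>2 + 1)) \<partial>lborel) < \<infinity>"
  proof -
    have half: "(\<integral>\<^sup>+ t. ennreal (1 / (t\<^sup>2 + 1)) * indicator {0..} t \<partial>lborel) = ennreal (pi / 2 - arctan 0)"
      by (rule nn_integral_FTC_atLeast)
         (auto intro!: derivative_eq_intros tendsto_arctan_at_top simp: field_simps add_nonneg_eq_0_iff)
    have "(\<integral>\<^sup>+ t. ennreal (1 / (t\<^sup>2 + 1)) \<partial>lborel) \<le>
        (\<integral>\<^sup>+ t. ennreal (1 / (t\<^sup>2 + 1)) * indicator {0..} t + ennreal (1 / ((0 + (-1) * t)\<^sup>2 + 1)) * indicator {0..} (0 + (-1) * t) \<partial>lborel)"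
      by (intro nn_integral_mono) (auto split: split_indicator)
    also have "\<dots> = ennreal (pi / 2) + (\<integral>\<^sup>+ t. ennreal (1 / ((0 + (-1) * t)\<^sup>2 + 1)) * indicator {0..} (0 + (-1) * t) \<partial>lborel)"
      by (subst nn_integral_add) (use half in auto)
    also have "(\<integral>\<^sup>+ t. ennreal (1 / ((0 + (-1) * t)\<^sup>2 + 1)) * indicator {0..} (0 + (-1) * t) \<partial>lborel) = ennreal (pi / 2)"
      using nn_integral_real_affine[of "\<lambda>t. ennreal (1 / (t\<^sup>2 + 1)) * indicator {0..} t" "-1" 0] half by simp
    finally show ?thesis by (auto simp: ennreal_plus[symmetric] less_top[symmetric] top_unique simp del: ennreal_plus)
  qed
  have "tadpole p \<le> (\<integral>\<^sup>+ x. (\<Prod>b\<in>Basis. ennreal (1 / ((x \<bullet> b)\<^sup>2 + 1))) \<partial>(lborel :: (real^4) measure))"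
    unfolding tadpole_def
  proof (rule nn_integral_mono)
    fix x :: "real^4"
    have "(\<Prod>b\<in>(Basis :: (real^4) set). (x \<bullet> b)\<^sup>2 + 1) \<le> (\<Prod>b\<in>(Basis :: (real^4) set). (norm x)\<^sup>2 + 1)"
      by (intro prod_mono) (auto intro!: Basis_le_norm abs_le_square_iff[THEN iffD1] simp: abs_le_square_iff[symmetric] Basis_le_norm)
    also have "\<dots> = ((norm x)\<^sup>2 + 1) ^ 4" by simp
    also have "\<dots> \<le> ((norm x)\<^sup>2 + 1) ^ p" using assms by (intro power_increasing) auto
    finally have le: "(\<Prod>b\<in>(Basis :: (real^4) set). (x \<bullet> b)\<^sup>2 + 1) \<le> ((norm x)\<^sup>2 + 1) ^ p" .
    have "1 / ((norm x)\<^sup>2 + 1) ^ p \<le> 1 / (\<Prod>b\<in>(Basis :: (real^4) set). (x \<bullet> b)\<^sup>2 + 1)"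
      by (intro divide_left_mono le mult_pos_pos prod_pos zero_less_power ballI add_nonneg_pos) auto
    also have "\<dots> = (\<Prod>b\<in>(Basis :: (real^4) set). 1 / ((x \<bullet> b)\<^sup>2 + 1))"
      by (simp add: prod_dividef)
    finally show "ennreal (1 / ((norm x)\<^sup>2 + 1) ^ p) \<le> (\<Prod>b\<in>(Basis :: (real^4) set). ennreal (1 / ((x \<bullet> b)\<^sup>2 + 1)))"
      by (subst prod_ennreal) (auto intro!: ennreal_leI)
  qed
  also have "\<dots> = (\<integral>\<^sup>+ f. (\<Prod>b\<in>(Basis :: (real^4) set). ennreal (1 / ((f b)\<^sup>2 + 1))) \<partial>(\<Pi>\<^sub>M b\<in>Basis. lborel))"
    by (subst lborel_eq, subst nn_integral_distr)
       (auto intro!: nn_integral_cong prod.cong simp: inner_sum_left inner_Basis if_distrib sum.delta cong: if_cong)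
  also have "\<dots> = (\<Prod>b\<in>(Basis :: (real^4) set). \<integral>\<^sup>+ t. ennreal (1 / (t\<^sup>2 + 1)) \<partial>lborel)"
    by (subst lborel_product.product_nn_integral_prod) auto
  also have "\<dots> < \<infinity>" using real_line by (simp add: power_less_top_ennreal)
  finally show ?thesis .
qed

section \<open>Elimination of the loop momenta\<close>

definition quadratic :: "nat \<Rightarrow> (nat \<Rightarrow> nat \<Rightarrow> real) \<Rightarrow> (nat \<Rightarrow> real^4) \<Rightarrow> real \<Rightarrow> (nat \<Rightarrow> real^4) \<Rightarrow> real" where
  "quadratic n M B c x = (\<Sum>k<n. \<Sum>l<n. M k l * (x k \<bullet> x l)) + 2 * (\<Sum>k<n. B k \<bullet> x k) + c"

text \<open>
  The coefficients left after the square in the variable \<open>x n\<close> has been completed: the Schur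
  complement of the pivot \<open>M n n\<close> in the matrix bordered by \<open>B\<close> and \<open>c\<close>.
\<close>

definition schur_M :: "nat \<Rightarrow> (nat \<Rightarrow> nat \<Rightarrow> real) \<Rightarrow> nat \<Rightarrow> nat \<Rightarrow> real" where
  "schur_M n M k l = M k l - M k n * M l n / M n n"
definition schur_B :: "nat \<Rightarrow> (nat \<Rightarrow> nat \<Rightarrow> real) \<Rightarrow> (nat \<Rightarrow> real^4) \<Rightarrow> nat \<Rightarrow> real^4" where
  "schur_B n M B k = B k - (M k n / M n n) *\<^sub>R B n"
definition schur_c :: "nat \<Rightarrow> (nat \<Rightarrow> nat \<Rightarrow> real) \<Rightarrow> (nat \<Rightarrow> real^4) \<Rightarrow> real \<Rightarrow> real" where
  "schur_c n M B c = c - (norm (B n))\<^sup>2 / M n n"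

text \<open>
  The product of all the pivots and of the last constant. With \<open>det M\<close> the first Symanzik polynomial,
  it is \<open>det M (c - \<langle>B, M\<^bsup>-1\<^esup> B\<rangle>)\<close>, the second one (with the mass terms included).
\<close>

fun symanzik :: "nat \<Rightarrow> (nat \<Rightarrow> nat \<Rightarrow> real) \<Rightarrow> (nat \<Rightarrow> real^4) \<Rightarrow> real \<Rightarrow> real" where
  "symanzik 0 M B c = c"
| "symanzik (Suc n) M B c = M n n * symanzik n (schur_M n M) (schur_B n M B) (schur_c n M B c)"

text \<open>
  Positive definiteness is tested on vectors with entries in \<open>\<real>\<^sup>4\<close>, so that it is inherited by the Schur
  complement directly from \<open>quadratic_complete_square\<close> for \<open>B = 0\<close>, \<open>c = 0\<close>.
\<close>

definition pos_def :: "nat \<Rightarrow> (nat \<Rightarrow> nat \<Rightarrow> real) \<Rightarrow> bool" where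
  "pos_def n M \<longleftrightarrow> (\<forall>x. (\<exists>k<n. x k \<noteq> 0) \<longrightarrow> quadratic n M (\<lambda>_. 0) 0 x > 0)"

lemma quadratic_cong: "(\<And>k. k < n \<Longrightarrow> x k = y k) \<Longrightarrow> quadratic n M B c x = quadratic n M B c y"
  unfolding quadratic_def by (intro arg_cong2[where f="(+)"] arg_cong2[where f="(*)"] sum.cong) auto

lemma quadratic_complete_square:
  assumes sym: "\<And>k. k < n \<Longrightarrow> M n k = M k n" and "M n n \<noteq> 0"
  shows "quadratic (Suc n) M B c x =
     M n n * (norm (x n + (1 / M n n) *\<^sub>R ((\<Sum>k<n. M k n *\<^sub>R x k) + B n)))\<^sup>2 +
     quadratic n (schur_M n M) (schur_B n M B) (schur_c n M B c) x"
proof -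
  define d where "d = M n n"
  define S where "S = (\<Sum>k<n. M k n *\<^sub>R x k)"
  define X where "X = (\<Sum>k<n. \<Sum>l<n. M k l * (x k \<bullet> x l))"
  define Y where "Y = (\<Sum>k<n. B k \<bullet> x k)"
  have d: "d \<noteq> 0" using assms by (simp add: d_def)
  have row: "(\<Sum>k<n. M k n * (x k \<bullet> v)) = S \<bullet> v" for v
    by (simp add: S_def inner_sum_left)
  have "(\<Sum>k<n. M n k * (x n \<bullet> x k)) = (\<Sum>k<n. M k n * (x k \<bullet> x n))"
    by (rule sum.cong) (auto simp: sym inner_commute)
  hence lhs: "quadratic (Suc n) M B c x = X + 2 * (S \<bullet> x n) + d * (x n \<bullet> x n) + 2 * Y + 2 * (B n \<bullet> x n) + c"
    by (simp add: quadratic_def X_def Y_def d_def sum.distrib row algebra_simps)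
  have "(\<Sum>k<n. \<Sum>l<n. schur_M n M k l * (x k \<bullet> x l)) = X - (\<Sum>k<n. \<Sum>l<n. (M k n * M l n / d) * (x k \<bullet> x l))"
    by (simp add: schur_M_def X_def d_def left_diff_distrib sum_subtractf)
  also have "(\<Sum>k<n. \<Sum>l<n. (M k n * M l n / d) * (x k \<bullet> x l)) = (S \<bullet> S) / d"
    unfolding S_def inner_sum_left inner_sum_right sum_divide_distrib
    by (intro sum.cong refl) (simp add: mult_ac inner_commute)
  finally have 1: "(\<Sum>k<n. \<Sum>l<n. schur_M n M k l * (x k \<bullet> x l)) = X - (S \<bullet> S) / d" .
  have "(\<Sum>k<n. schur_B n M B k \<bullet> x k) = Y - (\<Sum>k<n. M k n * (x k \<bullet> B n)) / d"
    by (simp add: schur_B_def Y_def d_def inner_diff_left sum_subtractf sum_divide_distrib inner_commute[of "B n"])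
  hence 2: "(\<Sum>k<n. schur_B n M B k \<bullet> x k) = Y - (S \<bullet> B n) / d" by (simp only: row)
  have 3: "d * (norm (x n + (1 / d) *\<^sub>R (S + B n)))\<^sup>2 =
      d * (x n \<bullet> x n) + 2 * (S \<bullet> x n) + 2 * (B n \<bullet> x n) + (S \<bullet> S + 2 * (S \<bullet> B n) + B n \<bullet> B n) / d"
    unfolding power2_norm_eq_inner using d
    by (simp add: inner_add_left inner_add_right inner_commute field_simps)
  have rhs: "quadratic n (schur_M n M) (schur_B n M B) (schur_c n M B c) x =
      X - (S \<bullet> S) / d + 2 * (Y - (S \<bullet> B n) / d) + (c - (B n \<bullet> B n) / d)"
    by (simp only: quadratic_def 1 2 schur_c_def d_def power2_norm_eq_inner)
  show ?thesis
    unfolding lhs rhs d_def[symmetric] S_def[symmetric] 3 by (simp add: add_divide_distrib)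
qed

context
  fixes n :: nat and M :: "nat \<Rightarrow> nat \<Rightarrow> real"
  assumes sym: "\<And>k l. k \<le> n \<Longrightarrow> l \<le> n \<Longrightarrow> M k l = M l k" and pd: "pos_def (Suc n) M"
begin

lemma pos_def_pivot: "M n n > 0"
proof -
  define x where "x = (\<lambda>_. 0)(n := axis 1 1 :: real^4)"
  have "\<exists>k<Suc n. x k \<noteq> 0" by (intro exI[of _ n]) (simp add: x_def axis_eq_0_iff)
  hence "quadratic (Suc n) M (\<lambda>_. 0) 0 x > 0" using pd by (auto simp: pos_def_def)
  also have "quadratic (Suc n) M (\<lambda>_. 0) 0 x = M n n"
    by (simp add: quadratic_def x_def inner_axis_axis)
  finally show ?thesis .
qed

text \<open>
  Every value of the smaller quadratic polynomial is a value of the larger one, namely its minimum in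
  the last variable. Hence both positivity and positive definiteness pass to the Schur complement.
\<close>

lemma complete_square_exists:
  "\<exists>v. (\<forall>k<n. v k = x k) \<and> quadratic (Suc n) M B c v =
     quadratic n (schur_M n M) (schur_B n M B) (schur_c n M B c) x"
proof -
  define w where "w = (1 / M n n) *\<^sub>R ((\<Sum>k<n. M k n *\<^sub>R x k) + B n)"
  have "(\<Sum>k<n. M k n *\<^sub>R (x(n := - w)) k) = (\<Sum>k<n. M k n *\<^sub>R x k)"
    by (rule sum.cong) auto
  hence "quadratic (Suc n) M B c (x(n := - w)) =
    quadratic n (schur_M n M) (schur_B n M B) (schur_c n M B c) (x(n := - w))"
    using pos_def_pivot by (subst quadratic_complete_square) (auto simp: sym w_def)
  also have "\<dots> = quadratic n (schur_M n M) (schur_B n M B) (schur_c n M B c) x"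
    by (rule quadratic_cong) auto
  finally show ?thesis by (intro exI[of _ "x(n := - w)"]) auto
qed

lemma pos_def_schur: "pos_def n (schur_M n M)"
  unfolding pos_def_def
proof (intro allI impI)
  fix x :: "nat \<Rightarrow> real^4" assume x: "\<exists>k<n. x k \<noteq> 0"
  obtain v where v: "\<forall>k<n. v k = x k"
    "quadratic (Suc n) M (\<lambda>_. 0) 0 v = quadratic n (schur_M n M) (schur_B n M (\<lambda>_. 0)) (schur_c n M (\<lambda>_. 0) 0) x"
    using complete_square_exists by blast
  have "schur_B n M (\<lambda>_. 0) = (\<lambda>_. 0)" "schur_c n M (\<lambda>_. 0) 0 = 0"
    by (auto simp: schur_B_def schur_c_def)
  moreover have "\<exists>k<Suc n. v k \<noteq> 0" using x v(1) less_Suc_eq by metis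
  hence "quadratic (Suc n) M (\<lambda>_. 0) 0 v > 0"
    using pd by (simp add: pos_def_def)
  ultimately show "quadratic n (schur_M n M) (\<lambda>_. 0) 0 x > 0" using v(2) by simp
qed

end

lemma quadratic_measurable [measurable]:
  "quadratic n M B c \<in> borel_measurable (\<Pi>\<^sub>M k\<in>{..<n}. lborel)"
proof -
  have [measurable]: "(\<lambda>x. x k) \<in> borel_measurable (\<Pi>\<^sub>M k\<in>{..<n}. (lborel :: (real^4) measure))" if "k < n" for k
    using that by (simp add: measurable_component_singleton cong: measurable_cong_sets)
  show ?thesis unfolding quadratic_def[abs_def] by measurable
qed

text \<open>
  Each integration uses up two of the \<open>2 n + 2\<close> powers and returns the pivot to the power \<open>-2\<close>; what
  is left at the end is the last constant to the same power.
\<close>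

theorem nn_integral_quadratic:
  assumes "\<And>k l. k < n \<Longrightarrow> l < n \<Longrightarrow> M k l = M l k" "pos_def n M" "\<And>x. quadratic n M B c x > 0"
  shows "(\<integral>\<^sup>+ x. ennreal (1 / quadratic n M B c x ^ (2*n+2)) \<partial>(\<Pi>\<^sub>M k\<in>{..<n}. lborel)) =
     ennreal (1 / (symanzik n M B c)\<^sup>2) * (\<Prod>k<n. tadpole (2*k+4))"
  using assms
proof (induction n arbitrary: M B c)
  case 0
  show ?case by (simp add: PiM_empty nn_integral_count_space_finite quadratic_def power2_eq_square)
next
  case (Suc n)
  let ?L = "\<lambda>n. \<Pi>\<^sub>M k\<in>{..<n}. (lborel :: (real^4) measure)"
  let ?M = "schur_M n M" and ?B = "schur_B n M B" and ?c = "schur_c n M B c"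
  have sym: "M k l = M l k" if "k \<le> n" "l \<le> n" for k l using Suc.prems(1) that by simp
  have pivot: "M n n > 0" using pos_def_pivot[of n M] sym Suc.prems(2) by blast
  have pos: "quadratic n ?M ?B ?c x > 0" for x
    using complete_square_exists[of n M x B c] sym Suc.prems(2,3) by metis
  have "(\<integral>\<^sup>+ x. ennreal (1 / quadratic (Suc n) M B c x ^ (2 * Suc n + 2)) \<partial>?L (Suc n)) =
    (\<integral>\<^sup>+ x. \<integral>\<^sup>+ y. ennreal (1 / quadratic (Suc n) M B c (x(n := y)) ^ (2 * Suc n + 2)) \<partial>lborel \<partial>?L n)"
    unfolding lessThan_Suc
    by (rule lborel_product.product_nn_integral_insert) (simp_all add: lessThan_Suc[symmetric])
  also have "\<dots> = (\<integral>\<^sup>+ x. ennreal (1 / ((M n n)\<^sup>2 * quadratic n ?M ?B ?c x ^ (2*n+2))) * tadpole (2*n+4) \<partial>?L n)"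
  proof (rule nn_integral_cong)
    fix x :: "nat \<Rightarrow> real^4"
    define w where "w = (1 / M n n) *\<^sub>R ((\<Sum>k<n. M k n *\<^sub>R x k) + B n)"
    have "quadratic (Suc n) M B c (x(n := y)) = M n n * (norm (y + w))\<^sup>2 + quadratic n ?M ?B ?c x" for y
    proof -
      have "(\<Sum>k<n. M k n *\<^sub>R (x(n := y)) k) = (\<Sum>k<n. M k n *\<^sub>R x k)" by (rule sum.cong) auto
      moreover have "quadratic n ?M ?B ?c (x(n := y)) = quadratic n ?M ?B ?c x" by (rule quadratic_cong) auto
      ultimately show ?thesis using pivot sym by (subst quadratic_complete_square) (auto simp: w_def)
    qed
    moreover have "2 * Suc n + 2 = (2*n+2) + 2" "2*n+4 = (2*n+2) + 2" by simp_all
    ultimately show "(\<integral>\<^sup>+ y. ennreal (1 / quadratic (Suc n) M B c (x(n := y)) ^ (2 * Suc n + 2)) \<partial>lborel) =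
      ennreal (1 / ((M n n)\<^sup>2 * quadratic n ?M ?B ?c x ^ (2*n+2))) * tadpole (2*n+4)"
      by (simp only: nn_integral_shifted_tadpole[OF pivot pos])
  qed
  also have "\<dots> = (\<integral>\<^sup>+ x. (ennreal (1 / (M n n)\<^sup>2) * tadpole (2*n+4)) * ennreal (1 / quadratic n ?M ?B ?c x ^ (2*n+2)) \<partial>?L n)"
  proof (rule nn_integral_cong)
    fix x :: "nat \<Rightarrow> real^4"
    have "1 / quadratic n ?M ?B ?c x ^ (2*n+2) \<ge> 0" using pos[of x] by simp
    hence "ennreal (1 / ((M n n)\<^sup>2 * quadratic n ?M ?B ?c x ^ (2*n+2))) =
        ennreal (1 / (M n n)\<^sup>2) * ennreal (1 / quadratic n ?M ?B ?c x ^ (2*n+2))"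
      by (simp add: ennreal_mult[symmetric] del: power_Suc)
    thus "ennreal (1 / ((M n n)\<^sup>2 * quadratic n ?M ?B ?c x ^ (2*n+2))) * tadpole (2*n+4) =
        (ennreal (1 / (M n n)\<^sup>2) * tadpole (2*n+4)) * ennreal (1 / quadratic n ?M ?B ?c x ^ (2*n+2))"
      by (simp only: mult_ac)
  qed
  also have "\<dots> = (ennreal (1 / (M n n)\<^sup>2) * tadpole (2*n+4)) *
      (ennreal (1 / (symanzik n ?M ?B ?c)\<^sup>2) * (\<Prod>k<n. tadpole (2*k+4)))"
  proof (subst nn_integral_cmult)
    have "?M k l = ?M l k" if "k < n" "l < n" for k l
      using sym that by (simp add: schur_M_def mult_ac)
    moreover have "pos_def n ?M" using sym Suc.prems(2) by (intro pos_def_schur) auto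
    ultimately show "(ennreal (1 / (M n n)\<^sup>2) * tadpole (2*n+4)) * (\<integral>\<^sup>+ x. ennreal (1 / quadratic n ?M ?B ?c x ^ (2*n+2)) \<partial>?L n) =
      (ennreal (1 / (M n n)\<^sup>2) * tadpole (2*n+4)) *
      (ennreal (1 / (symanzik n ?M ?B ?c)\<^sup>2) * (\<Prod>k<n. tadpole (2*k+4)))"
      using Suc.IH[OF _ _ pos] by simp
  qed measurable
  also have "\<dots> = (ennreal (1 / (M n n)\<^sup>2) * ennreal (1 / (symanzik n ?M ?B ?c)\<^sup>2)) * (\<Prod>k<Suc n. tadpole (2*k+4))"
    by (simp add: mult_ac)
  also have "ennreal (1 / (M n n)\<^sup>2) * ennreal (1 / (symanzik n ?M ?B ?c)\<^sup>2) = ennreal (1 / (symanzik (Suc n) M B c)\<^sup>2)"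
    by (simp add: ennreal_mult[symmetric] power_mult_distrib)
  finally show ?case .
qed

section \<open>The alternating matrix of a quadratic polynomial\<close>

text \<open>
  The quaternion \<open>v\<^sub>1 + v\<^sub>2 i + v\<^sub>3 j + v\<^sub>4 k\<close> as a complex \<open>2 \<times> 2\<close> matrix with rows and columns 0 and 1.
\<close>

definition quaternion :: "real^4 \<Rightarrow> nat \<Rightarrow> nat \<Rightarrow> complex" where
  "quaternion v s t =
     (if s = 0 then if t = 0 then Complex (vec_nth v 1) (vec_nth v 2) else Complex (vec_nth v 3) (vec_nth v 4)
      else if t = 0 then Complex (- vec_nth v 3) (vec_nth v 4) else Complex (vec_nth v 1) (- vec_nth v 2))"

lemma quaternion_det: "quaternion v 0 0 * quaternion v 1 1 - quaternion v 0 1 * quaternion v 1 0 = of_real ((norm v)\<^sup>2)"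
  by (simp add: quaternion_def norm_vec_def L2_set_def sum_4 real_sqrt_pow2 sum_nonneg complex_eq_iff power2_eq_square)

lemma quaternion_linear:
  "quaternion 0 s t = 0" "quaternion (v + w) s t = quaternion v s t + quaternion w s t"
  "quaternion (v - w) s t = quaternion v s t - quaternion w s t"
  "quaternion (r *\<^sub>R v) s t = r *\<^sub>R quaternion v s t"
  by (auto simp: quaternion_def complex_eq_iff)

lemma quaternion_sum: "quaternion (\<Sum>i\<in>I. v i) s t = (\<Sum>i\<in>I. quaternion (v i) s t)"
  by (induction I rule: infinite_finite_induct) (auto simp: quaternion_linear)

text \<open>
  A matrix of \<open>2 \<times> 2\<close> blocks. Block 0 belongs to the constant term and block \<open>k + 1\<close> to the loop
  momentum \<open>x k\<close>, so that the loop momentum eliminated first is the last block. A real coefficient \<open>r\<close>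
  contributes \<open>r\<close> times the symplectic block, a vector contributes its quaternion (this is the
  symplectic block times another quaternion of the same norm).
\<close>

definition momentum_matrix :: "(nat \<Rightarrow> nat \<Rightarrow> real) \<Rightarrow> (nat \<Rightarrow> real^4) \<Rightarrow> real \<Rightarrow> nat \<Rightarrow> nat \<Rightarrow> complex" where
  "momentum_matrix M B c i j =
     (let k = i div 2; s = i mod 2; l = j div 2; t = j mod 2 in
      if k = 0 \<and> l = 0 then of_real c * symplectic s t
      else if l = 0 then quaternion (B (k - 1)) s t
      else if k = 0 then - quaternion (B (l - 1)) t s
      else of_real (M (k - 1) (l - 1)) * symplectic s t)"

lemma momentum_matrix_antisym:
  assumes "\<And>k l. k < n \<Longrightarrow> l < n \<Longrightarrow> M k l = M l k" "i < 2*n+2" "j < 2*n+2"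
  shows "momentum_matrix M B c i j = - momentum_matrix M B c j i"
proof -
  have "i div 2 - 1 < n" if "i div 2 \<noteq> 0" using that assms(2) by linarith
  moreover have "j div 2 - 1 < n" if "j div 2 \<noteq> 0" using that assms(3) by linarith
  ultimately show ?thesis
    using assms(1)[of "i div 2 - 1" "j div 2 - 1"] symplectic_antisym[of "i mod 2" "j mod 2", where ?'a=complex]
    by (simp add: momentum_matrix_def Let_def del: div_eq_0_iff)
qed

lemma momentum_matrix_sum:
  "momentum_matrix (\<lambda>k l. \<Sum>i\<in>I. a i * M i k l) (\<lambda>k. \<Sum>i\<in>I. a i *\<^sub>R B i k) (\<Sum>i\<in>I. a i * c i) p q =
   (\<Sum>i\<in>I. a i *\<^sub>R momentum_matrix (M i) (B i) (c i) p q)"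
proof -
  have "of_real (\<Sum>i\<in>I. a i * r i) * z = (\<Sum>i\<in>I. a i *\<^sub>R (of_real (r i) * z))" for r :: "_ \<Rightarrow> real" and z :: complex
    unfolding of_real_sum sum_distrib_right by (intro sum.cong refl) (simp add: scaleR_conv_of_real mult_ac)
  thus ?thesis
    by (simp add: momentum_matrix_def Let_def quaternion_sum quaternion_linear sum_negf del: div_eq_0_iff of_real_sum)
qed

lemma momentum_matrix_block:
  assumes "s < 2" "t < 2"
  shows "momentum_matrix M B c (2*k+s) (2*l+t) =
    (if k = 0 \<and> l = 0 then of_real c * symplectic s t
      else if l = 0 then quaternion (B (k - 1)) s t
      else if k = 0 then - quaternion (B (l - 1)) t s
      else of_real (M (k - 1) (l - 1)) * symplectic s t)"
proof -
  have "(2*k+s) div 2 = k" "(2*k+s) mod 2 = s" "(2*l+t) div 2 = l" "(2*l+t) mod 2 = t" using assms by auto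
  thus ?thesis by (simp add: momentum_matrix_def Let_def del: div_eq_0_iff)
qed

text \<open>
  The elimination step of \<open>pfaffian_matrix_pivot\<close> is that of the quadratic polynomial. In block
  \<open>(0, 0)\<close> this is the fact that the determinant of a quaternion is the square of its norm.
\<close>

lemma momentum_matrix_pivot:
  fixes M :: "nat \<Rightarrow> nat \<Rightarrow> real" and B :: "nat \<Rightarrow> real^4" and c :: real
  assumes "M n n \<noteq> 0" "\<And>k. k < n \<Longrightarrow> M n k = M k n" "i < 2*n+2" "j < 2*n+2"
  defines "p \<equiv> 2 * Suc n" and "A \<equiv> momentum_matrix M B c"
  shows "A i j + (A i p * A (p+1) j - A i (p+1) * A p j) / of_real (M n n) =
    momentum_matrix (schur_M n M) (schur_B n M B) (schur_c n M B c) i j" (is "_ = ?R")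
proof -
  define k s l t where "k = i div 2" and "s = i mod 2" and "l = j div 2" and "t = j mod 2"
  have ij: "i = 2*k+s" "j = 2*l+t" by (auto simp: k_def s_def l_def t_def)
  have st: "s < 2" "t < 2" by (auto simp: s_def t_def)
  have kl: "k \<le> n" "l \<le> n" using assms(3,4) by (auto simp: k_def l_def)
  define b where "b = quaternion (B n)"
  define d where "d = complex_of_real (M n n)"
  have d: "d \<noteq> 0" using assms(1) by (simp add: d_def)
  have det: "of_real ((norm (B n))\<^sup>2) = b 0 0 * b 1 1 - b 0 1 * b 1 0"
    unfolding b_def by (rule quaternion_det[symmetric])
  have sym: "M n (l - 1) = M (l - 1) n" if "l \<noteq> 0" using assms(2)[of "l - 1"] kl that by simp
  have ip: "A i p = (if k = 0 then - b 0 s else of_real (M (k-1) n) * symplectic s 0)"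
    using momentum_matrix_block[OF st(1), of 0 M B c k "Suc n"] by (simp add: ij p_def A_def b_def)
  have iq: "A i (p+1) = (if k = 0 then - b 1 s else of_real (M (k-1) n) * symplectic s 1)"
    using momentum_matrix_block[OF st(1), of 1 M B c k "Suc n"] by (simp add: ij p_def A_def b_def)
  have pj: "A p j = (if l = 0 then b 0 t else of_real (M (l-1) n) * symplectic 0 t)"
    using momentum_matrix_block[OF _ st(2), of 0 M B c "Suc n" l] sym by (simp add: ij p_def A_def b_def)
  have qj: "A (p+1) j = (if l = 0 then b 1 t else of_real (M (l-1) n) * symplectic 1 t)"
    using momentum_matrix_block[OF _ st(2), of 1 M B c "Suc n" l] sym by (simp add: ij p_def A_def b_def)
  have s: "s = 0 \<or> s = 1" and t: "t = 0 \<or> t = 1" using st by auto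
  have block: "momentum_matrix M' B' c' i j =
    (if k = 0 \<and> l = 0 then of_real c' * symplectic s t
      else if l = 0 then quaternion (B' (k - 1)) s t
      else if k = 0 then - quaternion (B' (l - 1)) t s
      else of_real (M' (k - 1) (l - 1)) * symplectic s t)" for M' B' c'
    unfolding ij by (rule momentum_matrix_block[OF st])
  note Aij = block[of M B c, folded A_def]
  show ?thesis
  proof (cases "k = 0"; cases "l = 0")
    assume "k = 0" "l = 0"
    hence "A i j + (A i p * A (p+1) j - A i (p+1) * A p j) / d =
        of_real c * symplectic s t + (b 1 s * b 0 t - b 0 s * b 1 t) / d"
      unfolding ip iq pj qj by (simp add: Aij)
    also have "\<dots> = (of_real c - (b 0 0 * b 1 1 - b 0 1 * b 1 0) / d) * symplectic s t"
      using s t by (elim disjE) (auto simp: symplectic_def algebra_simps diff_divide_distrib)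
    also have "\<dots> = of_real (schur_c n M B c) * symplectic s t"
      unfolding det[symmetric] schur_c_def d_def of_real_diff of_real_divide ..
    also have "\<dots> = ?R" unfolding block using \<open>k = 0\<close> \<open>l = 0\<close> by simp
    finally show ?thesis by (simp only: d_def)
  next
    assume kl: "k = 0" "l \<noteq> 0"
    define m where "m = complex_of_real (M (l-1) n)"
    have "A i j + (A i p * A (p+1) j - A i (p+1) * A p j) / d =
        - quaternion (B (l-1)) t s + m * (b 1 s * symplectic 0 t - b 0 s * symplectic 1 t) / d"
      unfolding ip iq pj qj using kl by (simp add: Aij m_def algebra_simps)
    also have "\<dots> = - (quaternion (B (l-1)) t s - (m / d) * b t s)"
      using s t by (elim disjE) (auto simp: symplectic_def)
    also have "\<dots> = ?R"
      unfolding block m_def b_def d_def using kl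
      by (simp add: schur_B_def quaternion_linear(3,4)) (simp add: scaleR_conv_of_real)
    finally show ?thesis by (simp only: d_def)
  next
    assume kl: "k \<noteq> 0" "l = 0"
    define m where "m = complex_of_real (M (k-1) n)"
    have "A i j + (A i p * A (p+1) j - A i (p+1) * A p j) / d =
        quaternion (B (k-1)) s t + m * (symplectic s 0 * b 1 t - symplectic s 1 * b 0 t) / d"
      unfolding ip iq pj qj using kl by (simp add: Aij m_def algebra_simps)
    also have "\<dots> = quaternion (B (k-1)) s t - (m / d) * b s t"
      using s t by (elim disjE) (auto simp: symplectic_def)
    also have "\<dots> = ?R"
      unfolding block m_def b_def d_def using kl
      by (simp add: schur_B_def quaternion_linear(3,4)) (simp add: scaleR_conv_of_real)
    finally show ?thesis by (simp only: d_def)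
  next
    assume kl: "k \<noteq> 0" "l \<noteq> 0"
    define m m' where "m = complex_of_real (M (k-1) n)" and "m' = complex_of_real (M (l-1) n)"
    have "A i j + (A i p * A (p+1) j - A i (p+1) * A p j) / d = of_real (M (k-1) (l-1)) * symplectic s t +
        m * m' * (symplectic s 0 * symplectic 1 t - symplectic s 1 * symplectic 0 t) / d"
      unfolding ip iq pj qj using kl by (simp add: Aij m_def m'_def algebra_simps)
    also have "symplectic s 0 * symplectic 1 t - symplectic s 1 * symplectic 0 t = - (symplectic s t :: complex)"
      using s t by (elim disjE) (auto simp: symplectic_def)
    also have "of_real (M (k-1) (l-1)) * symplectic s t + m * m' * - symplectic s t / d =
        of_real (schur_M n M (k-1) (l-1)) * symplectic s t"
      by (simp add: schur_M_def d_def m_def m'_def algebra_simps)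
    also have "\<dots> = ?R" unfolding block using kl by simp
    finally show ?thesis by (simp only: d_def)
  qed
qed

theorem pfaffian_momentum_matrix:
  assumes "\<And>k l. k < n \<Longrightarrow> l < n \<Longrightarrow> M k l = M l k" "pos_def n M"
  shows "pfaffian_matrix (Suc n) (momentum_matrix M B c) = of_real (symanzik n M B c)"
  using assms
proof (induction n arbitrary: M B c)
  case 0
  have "momentum_matrix M B c i j = - momentum_matrix M B c j i" if "i < 2*0+2" "j < 2*0+2" for i j
    using that by (intro momentum_matrix_antisym[of 0]) auto
  hence "pfaffian_matrix (Suc 0) (momentum_matrix M B c) =
      momentum_matrix M B c (2*0) (2*0+1) * pfaffian_matrix 0 (momentum_matrix M B c)"
    by (rule pfaffian_matrix_direct_sum) auto
  hence "pfaffian_matrix (Suc 0) (momentum_matrix M B c) =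
      momentum_matrix M B c 0 1 * pfaffian_matrix 0 (momentum_matrix M B c)"
    by simp
  also have "momentum_matrix M B c 0 1 = of_real c" by (simp add: momentum_matrix_def symplectic_def)
  finally show ?case by (simp add: pfaffian_matrix_0)
next
  case (Suc n)
  let ?A = "momentum_matrix M B c" and ?p = "2 * Suc n"
  have sym: "M k l = M l k" if "k \<le> n" "l \<le> n" for k l using Suc.prems(1) that by simp
  have pivot: "M n n > 0" using pos_def_pivot[of n M] sym Suc.prems(2) by blast
  have Apq: "?A ?p (?p + 1) = of_real (M n n)"
    using momentum_matrix_block[of 0 1 M B c "Suc n" "Suc n"] by (simp add: symplectic_def)
  have "pfaffian_matrix (Suc (Suc n)) ?A = of_real (M n n) * pfaffian_matrix (Suc n)
     (\<lambda>i j. ?A i j + (?A i ?p * ?A (?p + 1) j - ?A i (?p + 1) * ?A ?p j) / of_real (M n n))"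
  proof -
    have "?A i j = - ?A j i" if "i < ?p + 2" "j < ?p + 2" for i j
      using Suc.prems(1) that by (rule momentum_matrix_antisym)
    moreover have "?A ?p (?p + 1) \<noteq> 0" using pivot by (simp only: Apq of_real_eq_0_iff)
    ultimately have "pfaffian_matrix (Suc (Suc n)) ?A = ?A ?p (?p + 1) * pfaffian_matrix (Suc n)
        (\<lambda>i j. ?A i j + (?A i ?p * ?A (?p + 1) j - ?A i (?p + 1) * ?A ?p j) / ?A ?p (?p + 1))"
      by (rule pfaffian_matrix_pivot)
    thus ?thesis by (simp only: Apq)
  qed
  also have "pfaffian_matrix (Suc n)
     (\<lambda>i j. ?A i j + (?A i ?p * ?A (?p + 1) j - ?A i (?p + 1) * ?A ?p j) / of_real (M n n)) =
     pfaffian_matrix (Suc n) (momentum_matrix (schur_M n M) (schur_B n M B) (schur_c n M B c))"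
    using pivot sym by (intro pfaffian_matrix_cong momentum_matrix_pivot) simp_all
  also have "\<dots> = of_real (symanzik n (schur_M n M) (schur_B n M B) (schur_c n M B c))"
  proof (rule Suc.IH)
    show "schur_M n M k l = schur_M n M l k" if "k < n" "l < n" for k l
      using sym that by (simp add: schur_M_def mult_ac)
    show "pos_def n (schur_M n M)" using sym Suc.prems(2) by (intro pos_def_schur) auto
  qed
  finally show ?case by simp
qed

section \<open>Forms given by matrices\<close>

definition matrix_form :: "nat \<Rightarrow> (nat \<Rightarrow> nat \<Rightarrow> 'a::real_normed_field) \<Rightarrow> (nat \<Rightarrow> real) \<Rightarrow> (nat \<Rightarrow> real) \<Rightarrow> 'a" where
  "matrix_form d A x y = (\<Sum>i<d. \<Sum>j<d. (x i * y j) *\<^sub>R A i j)"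

lemma alternating_matrix_form:
  assumes A: "\<And>i j. i < d \<Longrightarrow> j < d \<Longrightarrow> A i j = - A j i"
  shows "alternating_form d (matrix_form d A)"
proof -
  have "matrix_form d A (\<lambda>j. c * x j + y j) z = c *\<^sub>R matrix_form d A x z + matrix_form d A y z"
       "matrix_form d A z (\<lambda>j. c * x j + y j) = c *\<^sub>R matrix_form d A z x + matrix_form d A z y" for c x y z
    unfolding matrix_form_def scaleR_sum_right sum.distrib[symmetric]
    by (intro sum.cong refl; simp add: algebra_simps)+
  moreover have "matrix_form d A x x = 0" for x
  proof -
    have "matrix_form d A x x = (\<Sum>j<d. \<Sum>i<d. (x i * x j) *\<^sub>R A i j)"
      unfolding matrix_form_def by (rule sum.swap)
    also have "\<dots> = (\<Sum>j<d. \<Sum>i<d. - ((x j * x i) *\<^sub>R A j i))"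
    proof (intro sum.cong refl)
      fix i j assume "i \<in> {..<d}" "j \<in> {..<d}"
      hence "A i j = - A j i" by (intro A) auto
      thus "(x i * x j) *\<^sub>R A i j = - ((x j * x i) *\<^sub>R A j i)" by (simp add: mult.commute)
    qed
    also have "\<dots> = - matrix_form d A x x" by (simp add: matrix_form_def sum_negf)
    finally show ?thesis by (simp add: equal_neg_zero)
  qed
  ultimately show ?thesis by (simp add: alternating_form_def)
qed

lemma matrix_form_std_basis:
  assumes "p < d" "q < d"
  shows "matrix_form d A (std_basis p) (std_basis q) = A p q"
proof -
  have "(\<Sum>j<d. (std_basis p i * std_basis q j) *\<^sub>R A i j) = (if i = p then A i q else 0)" for i
  proof -
    have "(\<Sum>j<d. (std_basis p i * std_basis q j) *\<^sub>R A i j) =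
        (\<Sum>j<d. if j = q then if i = p then A i j else 0 else 0)"
      by (intro sum.cong) (auto simp: std_basis_def)
    thus ?thesis using assms by simp
  qed
  thus ?thesis using assms by (simp add: matrix_form_def)
qed

lemma pfaffian_integrand_matrix_form:
  "pfaffian_integrand n (\<lambda>i. matrix_form (2*n+2) (A i)) a =
   1 / (pfaffian_matrix (Suc n) (\<lambda>p q. \<Sum>i<2*n+2. a i *\<^sub>R A i p q))\<^sup>2"
proof -
  have "pfaffian_matrix (Suc n) (\<lambda>p q. \<Sum>i<2*n+2. a i *\<^sub>R matrix_form (2*n+2) (A i) (std_basis p) (std_basis q)) =
        pfaffian_matrix (Suc n) (\<lambda>p q. \<Sum>i<2*n+2. a i *\<^sub>R A i p q)"
    by (intro pfaffian_matrix_cong sum.cong refl arg_cong2[where f="(*\<^sub>R)"] matrix_form_std_basis) auto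
  thus ?thesis by (simp add: pfaffian_integrand_def pfaffian_def)
qed

lemma pfaffian_integrand_measurable [measurable]:
  fixes Q :: "nat \<Rightarrow> (nat \<Rightarrow> real) \<Rightarrow> (nat \<Rightarrow> real) \<Rightarrow> 'a::{real_normed_field, banach, second_countable_topology}"
  shows "(\<lambda>a. pfaffian_integrand n Q (a(2*n+1 := 1))) \<in> borel_measurable (\<Pi>\<^sub>M i\<in>{..<2*n+1}. lborel)"
proof -
  have [measurable]: "(\<lambda>a. (a(2*n+1 := 1)) i) \<in> borel_measurable (\<Pi>\<^sub>M i\<in>{..<2*n+1}. (lborel :: real measure))"
    if "i \<in> {..<2*n+2}" for i
  proof (cases "i = 2*n+1")
    case False
    hence "i \<in> {..<2*n+1}" using that by auto
    hence "(\<lambda>a. a i) \<in> (\<Pi>\<^sub>M i\<in>{..<2*n+1}. lborel) \<rightarrow>\<^sub>M (lborel :: real measure)"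
      by (rule measurable_component_singleton)
    thus ?thesis using False by simp
  qed simp
  show ?thesis
    unfolding pfaffian_integrand_def pfaffian_def pfaffian_matrix_def
    by (intro borel_measurable_divide borel_measurable_power borel_measurable_sum borel_measurable_prod
          borel_measurable_times borel_measurable_scaleR borel_measurable_const) measurable
qed

section \<open>The form attached to a propagator\<close>

text \<open>
  The coefficients of a quadratic polynomial on \<open>(\<real>\<^sup>4)\<^sup>n\<close> whose quadratic part is \<open>\<Sum> M\<^sub>k\<^sub>l \<langle>x\<^sub>k, x\<^sub>l\<rangle>\<close>,
  recovered from its values: the quadratic part by polarization at a fixed unit vector, the linear part as
  the odd part on the coordinate axes.
\<close>

definition quad_coeff :: "((nat \<Rightarrow> real^4) \<Rightarrow> real) \<Rightarrow> nat \<Rightarrow> nat \<Rightarrow> real" where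
  "quad_coeff P k l =
     (P (\<lambda>i. (if i = k then axis 1 1 else 0) + (if i = l then axis 1 1 else 0))
      - P (\<lambda>i. if i = k then axis 1 1 else 0) - P (\<lambda>i. if i = l then axis 1 1 else 0) + P (\<lambda>_. 0)) / 2"

definition lin_coeff :: "((nat \<Rightarrow> real^4) \<Rightarrow> real) \<Rightarrow> nat \<Rightarrow> real^4" where
  "lin_coeff P k = (\<chi> j. (P (\<lambda>i. if i = k then axis j 1 else 0) - P (\<lambda>i. if i = k then - axis j 1 else 0)) / 4)"

definition const_coeff :: "((nat \<Rightarrow> real^4) \<Rightarrow> real) \<Rightarrow> real" where
  "const_coeff P = P (\<lambda>_. 0)"

definition feynman_form :: "nat \<Rightarrow> ((nat \<Rightarrow> real^4) \<Rightarrow> real) \<Rightarrow> (nat \<Rightarrow> real) \<Rightarrow> (nat \<Rightarrow> real) \<Rightarrow> complex" where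
  "feynman_form n P = matrix_form (2*n+2) (momentum_matrix (quad_coeff P) (lin_coeff P) (const_coeff P))"

lemma quad_coeff_sym: "quad_coeff P k l = quad_coeff P l k"
  by (simp add: quad_coeff_def add.commute)

lemma alternating_feynman_form: "alternating_form (2*n+2) (feynman_form n P)"
  unfolding feynman_form_def
  by (intro alternating_matrix_form momentum_matrix_antisym[of n] quad_coeff_sym)

lemma propagator_coeffs:
  fixes b :: "nat \<Rightarrow> 'e \<Rightarrow> int" and s :: "'e \<Rightarrow> real^4" and m :: "'e \<Rightarrow> real" and n :: nat and e :: 'e
  defines "P \<equiv> propagator n b s m e"
  shows "k < n \<Longrightarrow> l < n \<Longrightarrow> quad_coeff P k l = of_int (b k e) * of_int (b l e)"
    and "k < n \<Longrightarrow> lin_coeff P k = of_int (b k e) *\<^sub>R s e"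
    and "const_coeff P = (norm (s e))\<^sup>2 + (m e)\<^sup>2"
proof -
  have single: "(\<Sum>j<n. of_int (b j e) *\<^sub>R (if j = k then v else 0)) = of_int (b k e) *\<^sub>R v"
    if "k < n" for k and v :: "real^4"
    using that by (simp add: if_distrib cong: if_cong)
  show "quad_coeff P k l = of_int (b k e) * of_int (b l e)" if "k < n" "l < n"
    using that unfolding quad_coeff_def P_def propagator_def
    by (simp add: scaleR_add_right sum.distrib single power2_norm_eq_inner inner_add_left inner_add_right
          inner_axis_axis inner_commute algebra_simps)
  show "lin_coeff P k = of_int (b k e) *\<^sub>R s e" if "k < n"
    using that unfolding lin_coeff_def P_def propagator_def
    by (simp add: Finite_Cartesian_Product.vec_eq_iff single power2_norm_eq_inner inner_add_left inner_add_right inner_diff_left inner_diff_right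
          inner_axis inner_axis' algebra_simps)
  show "const_coeff P = (norm (s e))\<^sup>2 + (m e)\<^sup>2"
    by (simp add: const_coeff_def P_def propagator_def)
qed

lemma propagator_eq_quadratic:
  fixes b :: "nat \<Rightarrow> 'e \<Rightarrow> int" and s :: "'e \<Rightarrow> real^4" and m :: "'e \<Rightarrow> real" and n :: nat and e :: 'e
  defines "P \<equiv> propagator n b s m e"
  shows "P x = quadratic n (quad_coeff P) (lin_coeff P) (const_coeff P) x"
proof -
  let ?S = "\<Sum>k<n. of_int (b k e) *\<^sub>R x k"
  have "(\<Sum>k<n. \<Sum>l<n. quad_coeff P k l * (x k \<bullet> x l)) = ?S \<bullet> ?S"
    unfolding inner_sum_left inner_sum_right P_def
    by (intro sum.cong refl) (simp add: propagator_coeffs mult_ac inner_commute)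
  moreover have "(\<Sum>k<n. lin_coeff P k \<bullet> x k) = s e \<bullet> ?S"
    unfolding inner_sum_right P_def by (intro sum.cong refl) (simp add: propagator_coeffs)
  ultimately show ?thesis
    unfolding quadratic_def by (simp add: P_def propagator_coeffs(3))
      (simp add: propagator_def power2_norm_eq_inner inner_add_left inner_add_right inner_commute)
qed

lemma quadratic_sum:
  "quadratic n (\<lambda>k l. \<Sum>i\<in>I. a i * M i k l) (\<lambda>k. \<Sum>i\<in>I. a i *\<^sub>R B i k) (\<Sum>i\<in>I. a i * c i) x =
   (\<Sum>i\<in>I. a i * quadratic n (M i) (B i) (c i) x)"
proof -
  have "(\<Sum>k<n. \<Sum>l<n. (\<Sum>i\<in>I. a i * M i k l) * (x k \<bullet> x l)) = (\<Sum>i\<in>I. a i * (\<Sum>k<n. \<Sum>l<n. M i k l * (x k \<bullet> x l)))"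
  proof -
    have "(\<Sum>k<n. \<Sum>l<n. (\<Sum>i\<in>I. a i * M i k l) * (x k \<bullet> x l)) =
        (\<Sum>k<n. \<Sum>l<n. \<Sum>i\<in>I. a i * (M i k l * (x k \<bullet> x l)))"
      by (simp add: sum_distrib_right mult.assoc)
    also have "\<dots> = (\<Sum>k<n. \<Sum>i\<in>I. \<Sum>l<n. a i * (M i k l * (x k \<bullet> x l)))"
      by (intro sum.cong refl sum.swap)
    also have "\<dots> = (\<Sum>i\<in>I. \<Sum>k<n. \<Sum>l<n. a i * (M i k l * (x k \<bullet> x l)))"
      by (rule sum.swap)
    finally show ?thesis by (simp add: sum_distrib_left)
  qed
  moreover have "(\<Sum>k<n. (\<Sum>i\<in>I. a i *\<^sub>R B i k) \<bullet> x k) = (\<Sum>i\<in>I. a i * (\<Sum>k<n. B i k \<bullet> x k))"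
    unfolding inner_sum_left sum_distrib_left by (subst sum.swap) simp
  ultimately show ?thesis
    unfolding quadratic_def by (simp add: distrib_left sum.distrib sum_distrib_left mult_ac)
qed

section \<open>Positivity from the integral basis of the homology\<close>

text \<open>
  A basis over the integers remains independent over the reals. Given a real relation with
  \<open>c k\<^sub>0 \<noteq> 0\<close>, normalize it to have the coefficient 1 at \<open>k\<^sub>0\<close>. By Dirichlet's theorem on
  simultaneous approximation some multiple by a positive integer \<open>q\<close> is so close to an integer vector \<open>p\<close>
  that the integer cycle with coordinates \<open>p\<close> has all its coefficients of absolute value less than 1. Thus it
  is zero although \<open>p k\<^sub>0 = q \<noteq> 0\<close>.
\<close>

lemma integral_H1_basis_real_independent:
  fixes c :: "nat \<Rightarrow> real"
  assumes basis: "integral_H1_basis G n b" and fin: "finite (arcs G)"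
    and zero: "\<And>e. e \<in> arcs G \<Longrightarrow> (\<Sum>k<n. c k * of_int (b k e)) = 0" and k0: "k\<^sub>0 < n"
  shows "c k\<^sub>0 = 0"
proof (rule ccontr)
  assume c0: "c k\<^sub>0 \<noteq> 0"
  let ?F = "\<lambda>c e. \<Sum>k<n. c k * b k e"
  \<comment> \<open>more than the sum of the absolute values of all coefficients, so that an approximation to within 1 / N suffices\<close>
  define N where "N = Suc (nat (\<Sum>e\<in>arcs G. \<Sum>k<n. \<bar>b k e\<bar>))"
  define \<theta> where "\<theta> k = c k / c k\<^sub>0" for k
  have "N > 0" by (simp add: N_def)
  then obtain q p where qp: "0 < q" "\<And>k. k < n \<Longrightarrow> \<bar>of_int q * \<theta> k - of_int (p k)\<bar> < 1 / N"
    by (rule Dirichlet_approx_simult[of N n \<theta>]) blast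
  have N1: "1 / real N \<le> 1" by (simp add: N_def)
  have "\<bar>of_int (q - p k\<^sub>0)\<bar> < (1 :: real)"
    using qp(2)[OF k0] c0 N1 by (simp add: \<theta>_def)
  hence pk0: "p k\<^sub>0 = q" by linarith
  have arcs0: "?F p e = 0" if e: "e \<in> arcs G" for e
  proof -
    have "(\<Sum>k<n. \<theta> k * of_int (b k e)) = (\<Sum>k<n. c k * of_int (b k e)) / c k\<^sub>0"
      by (simp add: \<theta>_def sum_divide_distrib)
    hence "(\<Sum>k<n. of_int q * \<theta> k * of_int (b k e)) = 0"
      using zero[OF e] by (simp add: sum_distrib_left[symmetric] mult.assoc)
    hence "of_int (?F p e) = (\<Sum>k<n. (of_int (p k) - of_int q * \<theta> k) * of_int (b k e))"
      by (simp add: left_diff_distrib sum_subtractf)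
    hence "\<bar>of_int (?F p e)\<bar> \<le> (\<Sum>k<n. \<bar>of_int q * \<theta> k - of_int (p k)\<bar> * \<bar>of_int (b k e)\<bar>)"
      by (simp add: sum_abs abs_mult[symmetric] abs_minus_commute order_trans[OF sum_abs])
    also have "\<dots> \<le> (\<Sum>k<n. 1 / N * \<bar>of_int (b k e)\<bar>)"
      using qp(2) by (intro sum_mono mult_right_mono) (auto intro: less_imp_le)
    also have "\<dots> = of_int (\<Sum>k<n. \<bar>b k e\<bar>) / N"
      by (simp add: sum_divide_distrib)
    also have "\<dots> < 1"
    proof -
      have "(\<Sum>k<n. \<bar>b k e\<bar>) \<le> (\<Sum>e\<in>arcs G. \<Sum>k<n. \<bar>b k e\<bar>)"
        using e fin by (intro member_le_sum) (auto intro: sum_nonneg)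
      hence "(\<Sum>k<n. \<bar>b k e\<bar>) < int N" by (simp add: N_def)
      hence "of_int (\<Sum>k<n. \<bar>b k e\<bar>) < (of_int (int N) :: real)" by (simp only: of_int_less_iff)
      thus ?thesis using \<open>N > 0\<close> by (simp add: divide_less_eq)
    qed
    finally have "of_int \<bar>?F p e\<bar> < (of_int 1 :: real)" by simp
    hence "\<bar>?F p e\<bar> < 1" by (simp only: of_int_less_iff)
    thus ?thesis by linarith
  qed
  let ?p = "\<lambda>k\<in>{..<n}. p k" and ?z = "\<lambda>k\<in>{..<n}. 0 :: int"
  have bij: "bij_betw ?F ({..<n} \<rightarrow>\<^sub>E UNIV) (H1 G)"
    using basis by (simp add: integral_H1_basis_def)
  have "?F ?p \<in> H1 G" using bij by (rule bij_betw_apply) (auto simp: PiE_def extensional_def)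
  hence "?F ?p e = 0" if "e \<notin> arcs G" for e using that by (auto simp: H1_def)
  moreover have "?F ?p e = ?F p e" for e by (rule sum.cong) auto
  ultimately have "?F ?p e = 0" for e using arcs0 by metis
  moreover have "?F ?z e = 0" for e by simp
  ultimately have "?F ?p = ?F ?z" by (intro ext) metis
  hence "?p = ?z"
    by (rule inj_onD[OF bij_betw_imp_inj_on[OF bij]]) (auto simp: PiE_def extensional_def)
  hence "p k\<^sub>0 = 0" using k0 by (metis lessThan_iff restrict_apply')
  thus False using pk0 qp(1) by simp
qed

section \<open>The amplitude as a Pfaffian integral\<close>

text \<open>
  For nonnegative integrands an equality of the integrals in \<open>[0, \<infinity>]\<close> contains both parts of the Pfaffian
  formula, convergence and value.
\<close>

lemma pfaffian_formulaI:
  fixes Q :: "nat \<Rightarrow> (nat \<Rightarrow> real) \<Rightarrow> (nat \<Rightarrow> real) \<Rightarrow> 'a::{real_normed_field, banach, second_countable_topology}"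
  assumes C: "C > 0"
    and meas: "amplitude_integrand n P \<in> borel_measurable (loop_momenta n)"
    and nonneg: "\<And>x. amplitude_integrand n P x \<ge> 0"
    and real: "AE a in (\<Pi>\<^sub>M i\<in>{..<2*n+1}. lborel). a \<in> affine_delta (2*n+1) \<longrightarrow>
        pfaffian_integrand n Q (a(2*n+1 := 1)) = of_real (norm (pfaffian_integrand n Q (a(2*n+1 := 1))))"
    and eq: "(\<integral>\<^sup>+ x. ennreal (amplitude_integrand n P x) \<partial>loop_momenta n) = ennreal C *
        (\<integral>\<^sup>+ a. ennreal (norm (pfaffian_integrand n Q (a(2*n+1 := 1)))) * indicator (affine_delta (2*n+1)) a
           \<partial>(\<Pi>\<^sub>M i\<in>{..<2*n+1}. lborel))"
  shows "pfaffian_formula n C P Q"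
proof -
  let ?L = "\<Pi>\<^sub>M i\<in>{..<2*n+1}. (lborel :: real measure)"
  define f where "f a = pfaffian_integrand n Q (a(2*n+1 := 1))" for a
  define g where "g a = indicator (affine_delta (2*n+1)) a * norm (f a)" for a :: "nat \<Rightarrow> real"
  have f_meas [measurable]: "f \<in> borel_measurable ?L" unfolding f_def by measurable
  have g_meas [measurable]: "g \<in> borel_measurable ?L" unfolding g_def by measurable
  have g0: "g a \<ge> 0" for a by (simp add: g_def)
  have "(\<integral>\<^sup>+ a. ennreal (g a) \<partial>?L) =
      (\<integral>\<^sup>+ a. ennreal (norm (f a)) * indicator (affine_delta (2*n+1)) a \<partial>?L)"
    by (intro nn_integral_cong) (auto simp: g_def split: split_indicator)
  hence eq': "(\<integral>\<^sup>+ x. ennreal (amplitude_integrand n P x) \<partial>loop_momenta n) = ennreal C * (\<integral>\<^sup>+ a. ennreal (g a) \<partial>?L)"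
    using eq by (simp only: f_def)
  have int_g: "integrable ?L g \<longleftrightarrow> (\<integral>\<^sup>+ a. ennreal (g a) \<partial>?L) < \<infinity>"
    using g0 g_meas by (simp add: integrable_iff_bounded)
  have amp: "integrable (loop_momenta n) (amplitude_integrand n P) \<longleftrightarrow> integrable ?L g"
  proof -
    have "integrable (loop_momenta n) (amplitude_integrand n P) \<longleftrightarrow>
        (\<integral>\<^sup>+ x. ennreal (amplitude_integrand n P x) \<partial>loop_momenta n) < \<infinity>"
      using meas nonneg by (simp add: integrable_iff_bounded)
    also have "\<dots> \<longleftrightarrow> (\<integral>\<^sup>+ a. ennreal (g a) \<partial>?L) < \<infinity>"
      unfolding eq' using C by (auto simp: ennreal_mult_less_top)
    finally show ?thesis by (simp only: int_g)
  qed
  have f_meas': "(\<lambda>a. indicator (affine_delta (2*n+1)) a *\<^sub>R f a) \<in> borel_measurable ?L" by measurable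
  have delta: "delta_integrable (2*n+1) (pfaffian_integrand n Q) \<longleftrightarrow> integrable ?L g"
  proof -
    have "(\<lambda>a. norm (indicator (affine_delta (2*n+1)) a *\<^sub>R f a)) = g" by (auto simp: g_def)
    thus ?thesis
      using integrable_norm_iff[OF f_meas'] by (simp add: delta_integrable_def set_integrable_def f_def)
  qed
  have AE_of_real: "AE a in ?L. indicator (affine_delta (2*n+1)) a *\<^sub>R f a = of_real (g a)"
    using real by eventually_elim (auto simp: g_def f_def split: split_indicator)
  have "delta_integral (2*n+1) (pfaffian_integrand n Q) = (\<integral>a. of_real (g a) \<partial>?L)"
    unfolding delta_integral_def set_lebesgue_integral_def f_def[symmetric]
    by (intro integral_cong_AE f_meas' AE_of_real) measurable
  also have "\<dots> = of_real (\<integral>a. g a \<partial>?L)"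
  proof (cases "integrable ?L g")
    case True
    thus ?thesis by (intro integral_bounded_linear bounded_linear_of_real)
  next
    case False
    hence "\<not> integrable ?L (\<lambda>a. of_real (g a) :: 'a)"
      using integrable_norm[of ?L "\<lambda>a. of_real (g a) :: 'a"] g0 by auto
    thus ?thesis using False by (simp add: not_integrable_integral_eq)
  qed
  finally have "delta_integral (2*n+1) (pfaffian_integrand n Q) = of_real (\<integral>a. g a \<partial>?L)" .
  moreover have "amplitude n P = C * (\<integral>a. g a \<partial>?L)"
  proof -
    have "amplitude n P = enn2real (ennreal C * (\<integral>\<^sup>+ a. ennreal (g a) \<partial>?L))"
      unfolding amplitude_def eq'[symmetric] using meas nonneg by (intro integral_eq_nn_integral) auto
    moreover have "(\<integral>a. g a \<partial>?L) = enn2real (\<integral>\<^sup>+ a. ennreal (g a) \<partial>?L)"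
      using g0 by (intro integral_eq_nn_integral g_meas) auto
    ultimately show ?thesis using C by (simp add: enn2real_mult)
  qed
  ultimately show ?thesis unfolding pfaffian_formula_def using amp delta by simp
qed

definition feynman_const :: "nat \<Rightarrow> real" where
  "feynman_const n = fact (2*n+1) * enn2real (\<Prod>k<n. tadpole (2*k+4))"

lemma prod_tadpole: "(\<Prod>k<n. tadpole (2*k+4)) = ennreal (enn2real (\<Prod>k<n. tadpole (2*k+4)))"
  and prod_tadpole_pos: "enn2real (\<Prod>k<n. tadpole (2*k+4)) > 0"
proof -
  have fin: "(\<Prod>k<n. tadpole (2*k+4)) < \<infinity>"
    using tadpole_finite[THEN less_imp_neq] by (simp add: less_top[symmetric] ennreal_prod_eq_top)
  thus "(\<Prod>k<n. tadpole (2*k+4)) = ennreal (enn2real (\<Prod>k<n. tadpole (2*k+4)))" by simp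
  have "(\<Prod>k<n. tadpole (2*k+4)) \<noteq> 0" using tadpole_pos by (auto simp: less_le)
  thus "enn2real (\<Prod>k<n. tadpole (2*k+4)) > 0"
    using fin by (simp add: enn2real_positive_iff zero_less_iff_neq_zero)
qed

lemma feynman_const_pos: "feynman_const n > 0"
  using prod_tadpole_pos[of n] by (simp add: feynman_const_def)

text \<open>
  The boundary of \<open>\<delta>\<close>, where the Pfaffian may vanish, is a null set.
\<close>

lemma AE_coordinates_nonzero:
  "AE a in (\<Pi>\<^sub>M i\<in>{..<d}. lborel). \<forall>i<(d::nat). a i \<noteq> (0::real)"
proof -
  let ?L = "\<Pi>\<^sub>M i\<in>{..<d}. (lborel :: real measure)"
  have "AE a in ?L. a i \<noteq> 0" if i: "i < d" for i
  proof (rule AE_I)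
    let ?N = "\<Pi>\<^sub>E j\<in>{..<d}. if j = i then {0 :: real} else UNIV"
    show "?N \<in> sets ?L" by (auto intro!: sets_PiM_I_finite)
    have "emeasure ?L ?N = (\<Prod>j<d. emeasure lborel (if j = i then {0 :: real} else UNIV))"
      by (rule lborel_product.emeasure_PiM) auto
    also have "\<dots> = 0" using i by (intro prod_zero) auto
    finally show "emeasure ?L ?N = 0" .
    show "{a \<in> space ?L. \<not> a i \<noteq> 0} \<subseteq> ?N" using i by (auto simp: space_PiM PiE_iff extensional_def)
  qed
  hence "AE a in ?L. \<forall>i\<in>{..<d}. a i \<noteq> 0" by (subst AE_ball_countable) auto
  thus ?thesis by (simp add: Ball_def)
qed

context
  fixes n :: nat and G :: "('v, nat) pre_digraph" and b q s m
  assumes data: "feynman_data n G b q s m"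
begin

private abbreviation (input) P where "P \<equiv> propagator n b s m"

lemma propagator_pos: "i < 2*n+2 \<Longrightarrow> P i x > 0"
  using data by (auto simp: feynman_data_def propagator_def intro!: add_nonneg_pos)

lemma propagator_measurable: "P i \<in> borel_measurable (loop_momenta n)"
proof -
  have "P i = quadratic n (quad_coeff (P i)) (lin_coeff (P i)) (const_coeff (P i))"
    by (rule ext) (rule propagator_eq_quadratic)
  thus ?thesis by (metis loop_momenta_def quadratic_measurable)
qed

lemma amplitude_integrand_measurable: "amplitude_integrand n P \<in> borel_measurable (loop_momenta n)"
  unfolding amplitude_integrand_def[abs_def]
  by (intro borel_measurable_divide borel_measurable_prod borel_measurable_const propagator_measurable)

lemma amplitude_integrand_pos: "amplitude_integrand n P x > 0"
  unfolding amplitude_integrand_def using propagator_pos by (intro divide_pos_pos prod_pos) simp_all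

text \<open>
  The form is \<open>\<Sum> a\<^sub>i |\<Sum>\<^sub>k \<alpha>\<^sub>k(e\<^sub>i) x\<^sub>k|\<^sup>2\<close>. If it vanished at \<open>x\<close>, every coordinate of \<open>x\<close> would give a real
  linear relation between the basis cycles.
\<close>

lemma pos_def_weighted:
  assumes a: "\<And>i. i < 2*n+2 \<Longrightarrow> a i > 0"
  shows "pos_def n (\<lambda>k l. \<Sum>i<2*n+2. a i * quad_coeff (P i) k l)"
  unfolding pos_def_def
proof (intro allI impI)
  fix x :: "nat \<Rightarrow> real^4"
  let ?S = "\<lambda>i. \<Sum>k<n. of_int (b k i) *\<^sub>R x k"
  assume "\<exists>k<n. x k \<noteq> 0"
  then obtain k j where k: "k < n" and kj: "vec_nth (x k) j \<noteq> 0"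
    by (auto simp: Finite_Cartesian_Product.vec_eq_iff)
  have arcs: "arcs G = {..<2*n+2}" using data by (simp add: feynman_data_def)
  have "\<exists>i<2*n+2. ?S i \<noteq> 0"
  proof (rule ccontr)
    assume "\<not> (\<exists>i<2*n+2. ?S i \<noteq> 0)"
    hence "vec_nth (?S i) j = 0" if "i < 2*n+2" for i using that by simp
    hence "(\<Sum>k<n. vec_nth (x k) j * of_int (b k i)) = 0" if "i \<in> arcs G" for i
      using that arcs by (simp add: mult.commute)
    hence "vec_nth (x k) j = 0"
      using data k arcs
      by (intro integral_H1_basis_real_independent[of G n b "\<lambda>k. vec_nth (x k) j"]) (auto simp: feynman_data_def)
    thus False using kj by simp
  qed
  then obtain i where i: "i < 2*n+2" "?S i \<noteq> 0" by blast
  have quad: "quadratic n (quad_coeff (P i)) (\<lambda>_. 0) 0 x = ?S i \<bullet> ?S i" for i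
    unfolding quadratic_def inner_sum_left inner_sum_right
    by (simp add: propagator_coeffs mult_ac inner_commute)
  have "quadratic n (\<lambda>k l. \<Sum>i<2*n+2. a i * quad_coeff (P i) k l) (\<lambda>_. 0) 0 x = (\<Sum>i<2*n+2. a i * (?S i \<bullet> ?S i))"
    using quadratic_sum[of n a "\<lambda>i. quad_coeff (P i)" "{..<2*n+2}" "\<lambda>_ _. 0" "\<lambda>_. 0" x]
    by (simp only: quad scaleR_zero_right sum.neutral_const mult_zero_right)
  also have "\<dots> > 0"
    using i a by (intro sum_pos2[of _ i]) (auto intro!: mult_nonneg_nonneg intro: less_imp_le)
  finally show "quadratic n (\<lambda>k l. \<Sum>i<2*n+2. a i * quad_coeff (P i) k l) (\<lambda>_. 0) 0 x > 0" .
qed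

lemma nn_integral_weighted_propagators:
  assumes a: "\<And>i. i < 2*n+2 \<Longrightarrow> a i > 0"
  defines "F \<equiv> pfaffian_integrand n (\<lambda>i. feynman_form n (P i)) a"
  shows "(\<integral>\<^sup>+ x. ennreal (1 / (\<Sum>i<2*n+2. a i * P i x) ^ (2*n+2)) \<partial>loop_momenta n) =
      ennreal (norm F) * (\<Prod>k<n. tadpole (2*k+4))" and "F = of_real (norm F)"
proof -
  define M where "M = (\<lambda>k l. \<Sum>i<2*n+2. a i * quad_coeff (P i) k l)"
  define B where "B = (\<lambda>k. \<Sum>i<2*n+2. a i *\<^sub>R lin_coeff (P i) k)"
  define c where "c = (\<Sum>i<2*n+2. a i * const_coeff (P i))"
  have sym: "M k l = M l k" for k l by (simp add: M_def quad_coeff_sym[of _ k l])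
  have pd: "pos_def n M" unfolding M_def using a by (rule pos_def_weighted)
  have quad: "quadratic n M B c x = (\<Sum>i<2*n+2. a i * P i x)" for x
    unfolding M_def B_def c_def quadratic_sum by (simp only: propagator_eq_quadratic[symmetric])
  have pos: "quadratic n M B c x > 0" for x
    unfolding quad using a propagator_pos by (intro sum_pos) auto
  have "F = 1 / (pfaffian_matrix (Suc n) (momentum_matrix M B c))\<^sup>2"
    unfolding F_def feynman_form_def pfaffian_integrand_matrix_form momentum_matrix_sum[symmetric] M_def B_def c_def ..
  also have "\<dots> = of_real (1 / (symanzik n M B c)\<^sup>2)"
    using sym pd by (subst pfaffian_momentum_matrix) auto
  finally have F: "F = of_real (1 / (symanzik n M B c)\<^sup>2)" .
  hence norm_F: "norm F = 1 / (symanzik n M B c)\<^sup>2" by (simp only: norm_of_real) simp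
  show "F = of_real (norm F)" unfolding norm_F by (rule F)
  show "(\<integral>\<^sup>+ x. ennreal (1 / (\<Sum>i<2*n+2. a i * P i x) ^ (2*n+2)) \<partial>loop_momenta n) =
      ennreal (norm F) * (\<Prod>k<n. tadpole (2*k+4))"
    unfolding quad[symmetric] norm_F loop_momenta_def by (rule nn_integral_quadratic[OF sym pd pos])
qed

theorem pfaffian_formula_feynman_form:
  "pfaffian_formula n (feynman_const n) P (\<lambda>i. feynman_form n (P i))"
proof (rule pfaffian_formulaI)
  let ?d = "2*n+1"
  let ?L = "\<Pi>\<^sub>M i\<in>{..<?d}. (lborel :: real measure)"
  let ?K = "enn2real (\<Prod>k<n. tadpole (2*k+4))"
  define F where "F a = pfaffian_integrand n (\<lambda>i. feynman_form n (P i)) (a(?d := 1))" for a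
  have weighted: "(\<integral>\<^sup>+ x. ennreal (1 / ((\<Sum>i<?d. a i * P i x) + P ?d x) ^ Suc ?d) \<partial>loop_momenta n) = ennreal (norm (F a)) * ennreal ?K"
    "F a = of_real (norm (F a))"
    if "\<forall>i<?d. a i \<noteq> 0" "a \<in> affine_delta ?d" for a
  proof -
    have pos: "(a(?d := 1)) i > 0" if "i < 2*n+2" for i
      using that \<open>\<forall>i<?d. a i \<noteq> 0\<close> \<open>a \<in> affine_delta ?d\<close> by (cases "i = ?d") (auto simp: affine_delta_def less_le)
    have "(\<Sum>i<2*n+2. (a(?d := 1)) i * P i x) = (\<Sum>i<?d. a i * P i x) + P ?d x" for x
      by (simp add: lessThan_Suc)
    thus "(\<integral>\<^sup>+ x. ennreal (1 / ((\<Sum>i<?d. a i * P i x) + P ?d x) ^ Suc ?d) \<partial>loop_momenta n) = ennreal (norm (F a)) * ennreal ?K"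
      using nn_integral_weighted_propagators(1)[of "a(?d := 1)", OF pos]
      by (simp only: F_def prod_tadpole[symmetric] Suc_eq_plus1 add.assoc one_add_one)
    show "F a = of_real (norm (F a))"
      unfolding F_def using pos by (rule nn_integral_weighted_propagators(2))
  qed
  show "AE a in ?L. a \<in> affine_delta ?d \<longrightarrow>
      pfaffian_integrand n (\<lambda>i. feynman_form n (P i)) (a(?d := 1)) =
      of_real (norm (pfaffian_integrand n (\<lambda>i. feynman_form n (P i)) (a(?d := 1))))"
    unfolding F_def[symmetric] using AE_coordinates_nonzero[of ?d] by eventually_elim (use weighted(2) in blast)
  interpret A: sigma_finite_measure ?L by (rule lborel_product.sigma_finite) simp
  interpret X: sigma_finite_measure "loop_momenta n"
    unfolding loop_momenta_def by (rule lborel_product.sigma_finite) simp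
  interpret pair_sigma_finite ?L "loop_momenta n" ..
  define f where "f a x = ennreal (1 / ((\<Sum>i<?d. a i * P i x) + P ?d x) ^ Suc ?d) * indicator (affine_delta ?d) a"
    for a :: "nat \<Rightarrow> real" and x
  have [measurable]: "P i \<in> borel_measurable (loop_momenta n)" for i by (rule propagator_measurable)
  have f_meas [measurable]: "case_prod f \<in> borel_measurable (?L \<Otimes>\<^sub>M loop_momenta n)"
    unfolding f_def[abs_def] by measurable
  have "(\<integral>\<^sup>+ x. ennreal (amplitude_integrand n P x) \<partial>loop_momenta n) =
      (\<integral>\<^sup>+ x. ennreal (fact ?d) * (\<integral>\<^sup>+ a. f a x \<partial>?L) \<partial>loop_momenta n)"
  proof (rule nn_integral_cong)
    fix x
    have "(\<integral>\<^sup>+ a. f a x \<partial>?L) = ennreal (1 / (fact ?d * (\<Prod>i<?d. P i x) * P ?d x))"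
      unfolding f_def by (rule feynman_parametrization) (auto intro: propagator_pos)
    moreover have "amplitude_integrand n P x = fact ?d * (1 / (fact ?d * (\<Prod>i<?d. P i x) * P ?d x))"
      by (simp add: amplitude_integrand_def lessThan_Suc mult_ac)
    ultimately show "ennreal (amplitude_integrand n P x) = ennreal (fact ?d) * (\<integral>\<^sup>+ a. f a x \<partial>?L)"
      by (simp only: ennreal_mult' fact_ge_zero)
  qed
  also have "\<dots> = ennreal (fact ?d) * (\<integral>\<^sup>+ x. \<integral>\<^sup>+ a. f a x \<partial>?L \<partial>loop_momenta n)"
    by (rule nn_integral_cmult) measurable
  also have "(\<integral>\<^sup>+ x. \<integral>\<^sup>+ a. f a x \<partial>?L \<partial>loop_momenta n) = (\<integral>\<^sup>+ a. \<integral>\<^sup>+ x. f a x \<partial>loop_momenta n \<partial>?L)"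
    by (rule Fubini') (rule f_meas)
  also have "\<dots> = (\<integral>\<^sup>+ a. ennreal ?K * (ennreal (norm (F a)) * indicator (affine_delta ?d) a) \<partial>?L)"
  proof (rule nn_integral_cong_AE)
    show "AE a in ?L. (\<integral>\<^sup>+ x. f a x \<partial>loop_momenta n) = ennreal ?K * (ennreal (norm (F a)) * indicator (affine_delta ?d) a)"
      using AE_coordinates_nonzero[of ?d]
    proof eventually_elim
      case (elim a)
      show ?case
      proof (cases "a \<in> affine_delta ?d")
        case True
        thus ?thesis using weighted(1)[OF elim True] by (simp add: f_def mult.commute)
      qed (simp add: f_def)
    qed
  qed
  also have "\<dots> = ennreal ?K * (\<integral>\<^sup>+ a. ennreal (norm (F a)) * indicator (affine_delta ?d) a \<partial>?L)"
    unfolding F_def by (rule nn_integral_cmult) measurable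
  also have "ennreal (fact ?d) * (ennreal ?K * (\<integral>\<^sup>+ a. ennreal (norm (F a)) * indicator (affine_delta ?d) a \<partial>?L)) =
      ennreal (feynman_const n) * (\<integral>\<^sup>+ a. ennreal (norm (F a)) * indicator (affine_delta ?d) a \<partial>?L)"
    by (simp add: feynman_const_def ennreal_mult' mult.assoc del: fact_Suc)
  finally show "(\<integral>\<^sup>+ x. ennreal (amplitude_integrand n P x) \<partial>loop_momenta n) = ennreal (feynman_const n) *
      (\<integral>\<^sup>+ a. ennreal (norm (pfaffian_integrand n (\<lambda>i. feynman_form n (P i)) (a(?d := 1)))) *
         indicator (affine_delta ?d) a \<partial>?L)"
    by (simp only: F_def)
qed (rule feynman_const_pos amplitude_integrand_measurable less_imp_le[OF amplitude_integrand_pos])+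

end

section \<open>Real forms\<close>

lemma pfaffian_integrand_multiples_of_standard:
  "pfaffian_integrand n (\<lambda>i. matrix_form (2*n+2) (\<lambda>p q. t i * symplectic p q)) a =
   1 / (\<Sum>i<2*n+2. a i * t i :: real) ^ (2*n+2)"
proof -
  have "(\<lambda>p q. \<Sum>i<2*n+2. a i *\<^sub>R (t i * symplectic p q)) =
      (\<lambda>p q. (\<Sum>i<2*n+2. a i * t i) * symplectic p q)"
    unfolding sum_distrib_right by (intro ext sum.cong refl) (simp only: real_scaleR_def mult.assoc)
  moreover have "(S ^ Suc n)\<^sup>2 = S ^ (2*n+2)" for S :: real
    by (simp only: power_mult[symmetric]) (simp add: mult.commute)
  ultimately show ?thesis
    by (simp only: pfaffian_integrand_matrix_form pfaffian_matrix_scale pfaffian_symplectic mult_1_right)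
qed

lemma emeasure_affine_delta:
  assumes "d > 0"
  shows "(\<integral>\<^sup>+ a. indicator (affine_delta d) a \<partial>(\<Pi>\<^sub>M i\<in>{..<d}. lborel)) = \<infinity>"
proof -
  let ?L = "\<Pi>\<^sub>M i\<in>{..<d}. (lborel :: real measure)"
  have "(\<integral>\<^sup>+ a. indicator (affine_delta d) a \<partial>?L) = (\<integral>\<^sup>+ a. indicator (\<Pi>\<^sub>E i\<in>{..<d}. {0..}) a \<partial>?L)"
    by (intro nn_integral_cong) (auto simp: indicator_def affine_delta_def space_PiM PiE_iff)
  also have "\<dots> = emeasure ?L (\<Pi>\<^sub>E i\<in>{..<d}. {0..})"
    by (rule nn_integral_indicator) (auto intro!: sets_PiM_I_finite)
  also have "\<dots> = (\<Prod>i<d. emeasure lborel {0 :: real ..})"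
    by (rule lborel_product.emeasure_PiM) auto
  also have "emeasure lborel {0 :: real ..} = \<infinity>"
  proof (rule ccontr)
    assume "emeasure lborel {0 :: real ..} \<noteq> \<infinity>"
    then obtain r where r: "emeasure lborel {0 :: real ..} = ennreal r" "r \<ge> 0"
      by (cases "emeasure lborel {0 :: real ..}") auto
    have "emeasure lborel {0 .. r + 1} \<le> emeasure lborel {0 :: real ..}"
      by (rule emeasure_mono) auto
    thus False using r by simp
  qed
  also have "(\<Prod>i<d. \<infinity> :: ennreal) = \<infinity>" using assms by (simp add: top_power_ennreal)
  finally show ?thesis .
qed

lemma nn_integral_loop_momenta_pos:
  assumes "f \<in> borel_measurable (loop_momenta n)" "\<And>x. f x > (0::real)"
  shows "(\<integral>\<^sup>+ x. ennreal (f x) \<partial>loop_momenta n) > 0"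
proof -
  have "(\<integral>\<^sup>+ x. ennreal (f x) \<partial>loop_momenta n) \<noteq> 0"
  proof
    assume "(\<integral>\<^sup>+ x. ennreal (f x) \<partial>loop_momenta n) = 0"
    hence "AE x in loop_momenta n. ennreal (f x) = 0"
      using assms(1) by (subst (asm) nn_integral_0_iff_AE) auto
    moreover have "ennreal (f x) \<noteq> 0" for x using assms(2)[of x] by simp
    ultimately have "ae_filter (loop_momenta n) = bot" by (simp add: trivial_limit_def)
    hence "emeasure (loop_momenta n) (space (loop_momenta n)) = 0" by (simp add: ae_filter_eq_bot_iff)
    moreover have "space (loop_momenta n) = (\<Pi>\<^sub>E i\<in>{..<n}. UNIV)" by (simp add: loop_momenta_def space_PiM)
    moreover have "emeasure (loop_momenta n) (\<Pi>\<^sub>E i\<in>{..<n}. UNIV) = (\<Prod>i<n. emeasure lborel (UNIV :: (real^4) set))"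
      unfolding loop_momenta_def by (rule lborel_product.emeasure_PiM) auto
    ultimately show False by simp
  qed
  thus ?thesis by (simp add: zero_less_iff_neq_zero)
qed

text \<open>
  Take \<open>Q\<^sub>i = t\<^sub>i \<omega>\<close> with the standard symplectic form \<open>\<omega>\<close>, so that the Pfaffian is
  \<open>(\<Sum> a\<^sub>i t\<^sub>i)\<^bsup>n+1\<^esup>\<close>. If all \<open>t\<^sub>i\<close> equal \<open>\<tau> > 0\<close>, then by Feynman's identity the integral over \<open>\<delta>\<close> is
  \<open>1 / ((2 n + 1)! \<tau>\<^bsup>2n+2\<^esup>)\<close>, which takes every positive value. If only the last \<open>t\<^sub>i\<close> is nonzero, then the
  integrand is constant on the affine chart, and the integral diverges.
\<close>

lemma real_pfaffian_formula_exists: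
  fixes P :: "nat \<Rightarrow> (nat \<Rightarrow> real^4) \<Rightarrow> real"
  assumes meas: "amplitude_integrand n P \<in> borel_measurable (loop_momenta n)"
    and pos: "\<And>x. amplitude_integrand n P x > 0" and C: "C > 0"
  shows "\<exists>Q :: nat \<Rightarrow> (nat \<Rightarrow> real) \<Rightarrow> (nat \<Rightarrow> real) \<Rightarrow> real.
    (\<forall>i<2*n+2. alternating_form (2*n+2) (Q i)) \<and> pfaffian_formula n C P Q"
proof -
  let ?d = "2*n+1"
  let ?L = "\<Pi>\<^sub>M i\<in>{..<?d}. (lborel :: real measure)"
  let ?A = "\<integral>\<^sup>+ x. ennreal (amplitude_integrand n P x) \<partial>loop_momenta n"
  define Q :: "(nat \<Rightarrow> real) \<Rightarrow> nat \<Rightarrow> (nat \<Rightarrow> real) \<Rightarrow> (nat \<Rightarrow> real) \<Rightarrow> real"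
    where "Q t i = matrix_form (2*n+2) (\<lambda>p q. t i * symplectic p q)" for t i
  have alt: "alternating_form (2*n+2) (Q t i)" for t i
    unfolding Q_def by (rule alternating_matrix_form) (subst symplectic_antisym, simp)
  have integrand: "pfaffian_integrand n (Q t) (a(?d := 1)) = 1 / ((\<Sum>i<?d. a i * t i) + t ?d) ^ Suc ?d" for t a
  proof -
    have "(\<Sum>i<2*n+2. (a(?d := 1)) i * t i) = (\<Sum>i<?d. a i * t i) + t ?d"
      by (simp add: lessThan_Suc)
    moreover have "2*n+2 = Suc ?d" by simp
    ultimately show ?thesis
      unfolding Q_def[abs_def] pfaffian_integrand_multiples_of_standard by (simp only:)
  qed
  have formula: "pfaffian_formula n C P (Q t)"
    if "?A = ennreal C * (\<integral>\<^sup>+ a. ennreal (1 / ((\<Sum>i<?d. a i * t i) + t ?d) ^ Suc ?d) * indicator (affine_delta ?d) a \<partial>?L)" for t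
  proof (rule pfaffian_formulaI[OF C meas less_imp_le[OF pos]])
    have even_power: "norm (1 / z ^ Suc ?d) = 1 / z ^ Suc ?d" for z :: real
    proof -
      have "z ^ Suc ?d \<ge> 0" by (rule zero_le_even_power) simp
      thus ?thesis by (simp del: power_Suc)
    qed
    show "AE a in ?L. a \<in> affine_delta ?d \<longrightarrow>
        pfaffian_integrand n (Q t) (a(?d := 1)) = of_real (norm (pfaffian_integrand n (Q t) (a(?d := 1))))"
      unfolding integrand even_power by simp
    show "?A = ennreal C * (\<integral>\<^sup>+ a. ennreal (norm (pfaffian_integrand n (Q t) (a(?d := 1)))) *
        indicator (affine_delta ?d) a \<partial>?L)"
      unfolding integrand even_power by (rule that)
  qed
  show ?thesis
  proof (cases "?A = \<infinity>")
    case True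
    define t :: "nat \<Rightarrow> real" where "t i = (if i = ?d then 1 else 0)" for i
    have "(\<Sum>i<?d. a i * t i) + t ?d = 1" for a by (simp add: t_def)
    hence "pfaffian_formula n C P (Q t)"
      using True C emeasure_affine_delta[of ?d] by (intro formula) (simp add: ennreal_mult_top)
    thus ?thesis using alt by blast
  next
    case False
    define A where "A = enn2real ?A"
    have A: "?A = ennreal A" "A > 0"
      using False nn_integral_loop_momenta_pos[OF meas pos] by (auto simp: A_def enn2real_positive_iff less_top)
    define \<tau> where "\<tau> = root (2*n+2) (C / (A * fact ?d))"
    have \<tau>: "\<tau> > 0" "\<tau> ^ Suc ?d = C / (A * fact ?d)"
      using A C by (auto simp: \<tau>_def real_root_gt_zero real_root_pow_pos2 simp del: fact_Suc power_Suc)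
    have "(\<integral>\<^sup>+ a. ennreal (1 / ((\<Sum>i<?d. a i * \<tau>) + \<tau>) ^ Suc ?d) * indicator (affine_delta ?d) a \<partial>?L) =
        ennreal (1 / (fact ?d * (\<Prod>i<?d. \<tau>) * \<tau>))"
      using \<tau> by (intro feynman_parametrization)
    also have "1 / (fact ?d * (\<Prod>i<?d. \<tau>) * \<tau>) = A / C"
    proof -
      have "fact ?d * (\<Prod>i<?d. \<tau>) * \<tau> = fact ?d * \<tau> ^ Suc ?d" by simp
      thus ?thesis unfolding \<tau>(2) using A C by simp
    qed
    finally have "pfaffian_formula n C P (Q (\<lambda>_. \<tau>))"
      using A C by (intro formula) (simp add: ennreal_mult[symmetric])
    thus ?thesis using alt by blast
  qed
qed

section \<open>The Pfaffian formula for Feynman amplitudes\<close>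

theorem theorem1p1:
  shows "\<exists>C :: nat \<Rightarrow> real.
    (\<exists>Q :: nat \<Rightarrow> ((nat \<Rightarrow> real^4) \<Rightarrow> real) \<Rightarrow> (nat \<Rightarrow> real) \<Rightarrow> (nat \<Rightarrow> real) \<Rightarrow> complex.
       \<forall>n \<ge> 1. \<forall>(G :: (nat, nat) pre_digraph) b q s m. feynman_data n G b q s m \<longrightarrow>
         (\<forall>i<2*n+2. alternating_form (2*n+2) (Q n (propagator n b s m i))) \<and>
         pfaffian_formula n (C n) (propagator n b s m) (\<lambda>i. Q n (propagator n b s m i))) \<and>
    (\<forall>n \<ge> 1. \<forall>(G :: (nat, nat) pre_digraph) b q s m. feynman_data n G b q s m \<longrightarrow>
       (\<exists>Q :: nat \<Rightarrow> (nat \<Rightarrow> real) \<Rightarrow> (nat \<Rightarrow> real) \<Rightarrow> real.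
         (\<forall>i<2*n+2. alternating_form (2*n+2) (Q i)) \<and>
         pfaffian_formula n (C n) (propagator n b s m) Q))"
proof (rule exI[of _ feynman_const], intro conjI)
  show "\<exists>Q :: nat \<Rightarrow> ((nat \<Rightarrow> real^4) \<Rightarrow> real) \<Rightarrow> (nat \<Rightarrow> real) \<Rightarrow> (nat \<Rightarrow> real) \<Rightarrow> complex.
       \<forall>n \<ge> 1. \<forall>(G :: (nat, nat) pre_digraph) b q s m. feynman_data n G b q s m \<longrightarrow>
         (\<forall>i<2*n+2. alternating_form (2*n+2) (Q n (propagator n b s m i))) \<and>
         pfaffian_formula n (feynman_const n) (propagator n b s m) (\<lambda>i. Q n (propagator n b s m i))"
    by (intro exI[of _ feynman_form] allI impI conjI alternating_feynman_form)
       (rule pfaffian_formula_feynman_form)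
  show "\<forall>n \<ge> 1. \<forall>(G :: (nat, nat) pre_digraph) b q s m. feynman_data n G b q s m \<longrightarrow>
       (\<exists>Q :: nat \<Rightarrow> (nat \<Rightarrow> real) \<Rightarrow> (nat \<Rightarrow> real) \<Rightarrow> real.
         (\<forall>i<2*n+2. alternating_form (2*n+2) (Q i)) \<and>
         pfaffian_formula n (feynman_const n) (propagator n b s m) Q)"
    by (intro allI impI real_pfaffian_formula_exists)
       (auto intro: amplitude_integrand_measurable amplitude_integrand_pos feynman_const_pos)
qed

end
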